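(* There exist absolute constants $C_1, C_2, \eta^*>0$ such that for every $0<\eta\le\eta^*$, setting $\lambda = \mathrm{e}^{-1}+\eta$, $$\lim_{n\to\infty}\mathbb{P}\Big(n\,\mathrm{e}^{-C_1/\sqrt{\eta}} \le L(n,\lambda) \le n\,\mathrm{e}^{-C_2/\sqrt{\eta}}\Big) = 1.$$
   Context: Let $\mathcal W_n$ be the complete graph on $n$ vertices in which each edge $e$ carries an independent weight $W_e$ that is exponentially distributed with mean $n$. A path $\pi=(v_0,v_1,\dots,v_m)$ is a tuple of distinct vertices; its length is $len(\pi)=m$ and its average weight is $A(\pi)=\frac1m\sum_{i=1}^m W_{(v_{i-1},v_i)}$. For $\lambda>0$, $L(n,\lambda)=\max\{len(\pi): \pi \text{ a path in } \mathcal W_n,\ A(\pi)\le\lambda\}$. *)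

theory Defs
  imports "HOL-Probability.Probability"
begin

definition edges :: "nat \<Rightarrow> nat set set" where
  "edges n = {e. \<exists>u v. u < n \<and> v < n \<and> u \<noteq> v \<and> e = {u, v}}"

definition weight_space :: "nat \<Rightarrow> (nat set \<Rightarrow> real) measure" where
  "weight_space n = PiM (edges n) (\<lambda>_. density lborel (exponential_density (1 / real n)))"

definition is_path :: "nat \<Rightarrow> nat list \<Rightarrow> bool" where
  "is_path n xs \<longleftrightarrow> distinct xs \<and> set xs \<subseteq> {..<n} \<and> length xs \<ge> 2"

definition path_len :: "nat list \<Rightarrow> nat" where
  "path_len xs = length xs - 1"

definition avg_weight :: "(nat set \<Rightarrow> real) \<Rightarrow> nat list \<Rightarrow> real" where
  "avg_weight W xs = (\<Sum>i<path_len xs. W {xs ! i, xs ! Suc i}) / real (path_len xs)"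

definition Lmax :: "nat \<Rightarrow> real \<Rightarrow> (nat set \<Rightarrow> real) \<Rightarrow> nat" where
  "Lmax n lam W = Max (insert 0 {path_len xs | xs. is_path n xs \<and> avg_weight W xs \<le> lam})"

end

theory Submission
  imports Defs "HOL-Real_Asymp.Real_Asymp"
begin

text \<open>
  Round the weights to multiples of a small \<open>c\<close> and follow along a path the height, which a step with
  rounded weight \<open>j c\<close> changes by \<open>j - L\<close>, where \<open>L c\<close> is close to \<open>1/e\<close>. The expected number of
  steps from height \<open>x\<close> to height \<open>y\<close> is \<open>c\<close> for each \<open>y > x - L\<close>, and this transfer operator has the
  explicit oscillating eigenfunctions \<open>r^x sin(\<phi> x + \<psi>)\<close>. Hence paths confined to a band of width
  \<open>const/\<surd>\<eta>\<close> are subcritical or supercritical according to the constant.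

  Upper bound: a path of length \<open>\<delta> n\<close> and average at most \<open>1/e + \<eta>\<close>, measured against the slope
  \<open>1/e + 2\<eta>\<close>, goes down in total by a multiple of \<open>\<delta> \<eta> n\<close>, so it contains linearly many edge-disjoint
  pieces descending by \<open>K \<approx> const/\<surd>\<eta>\<close> without ever rising by \<open>K\<close>. The expected number of such descents
  from a given vertex is at most \<open>e^(-const/\<surd>\<eta>)\<close>, and a union bound over \<open>k\<close> starting vertices
  costs \<open>n choose k\<close>.

  Lower bound: depth-first search for paths whose height stays in a supercritical band, keeping the
  current path on a stack. An exponential supermartingale shows that the eigenfunction summed over the
  discovered vertices exceeds its sum over the finished ones by a factor \<open>1 + const \<eta>\<close>; the surplus
  must sit on the stack, so the stack reaches length \<open>e^(-const/\<surd>\<eta>) n\<close> at some time.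
\<close>

section \<open>The eigenfunctions\<close>

text \<open>The function \<open>(1 - z) * z ^ (L - 1)\<close> on [0, 1] has maximum about
  \<open>1 / (e L)\<close>; this is the origin of the threshold 1/e for \<open>L c\<close>. Above it
  the eigenvalue equation has no root in [0, 1]: a pair of roots leaves the real axis at angle
  \<open>\<phi> = u / L\<close>, and \<open>L c - 1/e\<close> is of order \<open>u^2\<close> because
  the maximum is quadratic. An excess \<eta> therefore means u of order \<surd>\<eta>, and the
  eigenfunction changes sign after \<open>pi L / u\<close> heights, that is, const/\<surd>\<eta>
  blocks of \<open>L\<close> heights. Its modulus falls by a constant factor over each block, which
  produces the factor e^(-const/\<surd>\<eta>) in both bounds. A first moment over whole paths
  cannot replace the local descents: for small \<eta> and M/n, the expected number of light paths
  with M edges is to leading exponential order (1 + e \<eta>)^M e^(-M^2/(2n)), which becomes small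
  only when M exceeds order \<eta> n. Weights are rounded down in the upper bound and up in the
  lower bound, so that either discretization errs on the safe side.\<close>

lemma cos_ge_quadratic:
  fixes x :: real assumes "0 \<le> x"
  shows "1 - x\<^sup>2 / 2 \<le> cos x"
proof -
  have "(\<lambda>y. cos y - (1 - y\<^sup>2 / 2)) 0 \<le> (\<lambda>y. cos y - (1 - y\<^sup>2 / 2)) x"
    by (rule DERIV_nonneg_imp_nondecreasing[OF assms])
      (auto intro!: derivative_eq_intros exI simp: sin_x_le_x)
  then show ?thesis by simp
qed

lemma sin_ge_cubic:
  fixes x :: real assumes "0 \<le> x"
  shows "x - x ^ 3 / 6 \<le> sin x"
proof -
  have "(\<lambda>y. sin y - (y - y ^ 3 / 6)) 0 \<le> (\<lambda>y. sin y - (y - y ^ 3 / 6)) x"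
  proof (rule DERIV_nonneg_imp_nondecreasing[OF assms])
    fix y :: real assume "0 \<le> y" "y \<le> x"
    then show "\<exists>d. ((\<lambda>y. sin y - (y - y ^ 3 / 6)) has_real_derivative d) (at y) \<and> 0 \<le> d"
      using cos_ge_quadratic[of y]
      by (intro exI[of _ "cos y - (1 - y\<^sup>2 / 2)"]) (auto intro!: derivative_eq_intros)
  qed
  then show ?thesis by simp
qed

lemma cos_le_quartic:
  fixes x :: real assumes "0 \<le> x"
  shows "cos x \<le> 1 - x\<^sup>2 / 2 + x ^ 4 / 24"
proof -
  have "(\<lambda>y. 1 - y\<^sup>2 / 2 + y ^ 4 / 24 - cos y) 0 \<le> (\<lambda>y. 1 - y\<^sup>2 / 2 + y ^ 4 / 24 - cos y) x"
  proof (rule DERIV_nonneg_imp_nondecreasing[OF assms])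
    fix y :: real assume "0 \<le> y" "y \<le> x"
    then show "\<exists>d. ((\<lambda>y. 1 - y\<^sup>2 / 2 + y ^ 4 / 24 - cos y) has_real_derivative d) (at y) \<and> 0 \<le> d"
      using sin_ge_cubic[of y]
      by (intro exI[of _ "sin y - (y - y ^ 3 / 6)"])
        (auto intro!: derivative_eq_intros simp: power3_eq_cube)
  qed
  then show ?thesis by simp
qed

lemma sin_pos_le_one: "0 < x \<Longrightarrow> x \<le> 1 \<Longrightarrow> 0 < sin x" for x :: real
  by (rule sin_gt_zero) (use pi_gt3 in auto)

text \<open>For large \<open>L\<close> the logarithm of \<open>ratio L x ^ (L - 1)\<close> tends to
  \<open>- x * cot x\<close>, so the quadratic gap between \<open>x * cot x\<close> and 1 measures
  how far the rate lies above the threshold.\<close>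

lemma x_cot_le:
  fixes x :: real assumes "0 < x" "x \<le> 1"
  shows "x * cot x \<le> 1 - x\<^sup>2 / 4"
proof -
  have s: "0 < sin x" using assms by (rule sin_pos_le_one)
  have "x * cos x \<le> x * (1 - x\<^sup>2 / 2 + x ^ 4 / 24)"
    using cos_le_quartic[of x] assms by (intro mult_left_mono) auto
  \<comment> \<open>The product has the same quartic term \<open>x^4 / 24\<close> and a larger
    quadratic one; its second factor is the cubic lower bound for the sine, divided by
    \<open>x\<close>.\<close>
  also have "\<dots> \<le> x * ((1 - x\<^sup>2 / 4) * (1 - x\<^sup>2 / 6))"
    using assms by (intro mult_left_mono) (auto simp: field_simps power2_eq_square power4_eq_xxxx)
  also have "\<dots> = (1 - x\<^sup>2 / 4) * (x - x ^ 3 / 6)"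
    by (simp add: field_simps power2_eq_square power3_eq_cube)
  also have "\<dots> \<le> (1 - x\<^sup>2 / 4) * sin x"
    using sin_ge_cubic[of x] assms by (intro mult_left_mono) (auto intro: order_trans[of _ "1\<^sup>2"] simp: power_le_one)
  finally show ?thesis using s by (simp add: cot_def field_simps)
qed

lemma x_cot_ge:
  fixes x :: real assumes "0 < x" "x \<le> 1"
  shows "1 - x\<^sup>2 / 2 \<le> x * cot x"
proof -
  have s: "0 < sin x" using assms by (rule sin_pos_le_one)
  have "x\<^sup>2 \<le> 1" using assms by (simp add: power_le_one)
  then have c: "0 \<le> cos x" using cos_ge_quadratic[of x] assms by linarith
  have "cos x * sin x \<le> cos x * x" using sin_x_le_x[of x] assms c by (intro mult_left_mono) auto
  then have "cos x \<le> x * cot x" using s by (simp add: cot_def field_simps)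
  then show ?thesis using cos_ge_quadratic[of x] assms by linarith
qed

lemma cot_nonneg_le_one: "0 < x \<Longrightarrow> x \<le> 1 \<Longrightarrow> 0 \<le> cot x" for x :: real
  using cot_gt_zero[of x] pi_gt3 by auto

text \<open>These come from solving \<open>(1 - \<zeta>) \<zeta>^(L - 1) = c\<close> with \<open>\<zeta> = r e^(i \<phi>)\<close> and \<open>\<phi> = u / L\<close>: the
  argument of the equation gives \<open>r\<close> (\<open>ratio\<close>), its modulus gives \<open>c\<close> (\<open>rate\<close>), and \<open>wave\<close> is the
  imaginary part of \<open>e^(i \<psi>) \<zeta>^i\<close>.\<close>

definition ratio :: "nat \<Rightarrow> real \<Rightarrow> real" where
  "ratio L u = sin (u - u / L) / sin u"

definition rate :: "nat \<Rightarrow> real \<Rightarrow> real" where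
  "rate L u = sin (u / L) / sin u * ratio L u ^ (L - 1)"

definition wave :: "nat \<Rightarrow> real \<Rightarrow> real \<Rightarrow> int \<Rightarrow> real" where
  "wave L u \<psi> i = ratio L u powi i * sin (u / L * i + \<psi>)"

section \<open>Difference equation of the wave and estimates for \<open>ratio\<close> and
  \<open>rate\<close>\<close>

context
  fixes L :: nat and u :: real
  assumes L: "2 \<le> L" and u: "0 < u" "u \<le> 1"
begin

lemma sin_u_pos: "0 < sin u"
  using u by (rule sin_pos_le_one)

lemma angle_pos: "0 < u / L" "u / L < u" "u / L \<le> 1"
  using L u by (auto simp: field_simps)

lemma ratio_pos: "0 < ratio L u"
  unfolding ratio_def using angle_pos u by (intro divide_pos_pos sin_pos_le_one) auto

lemma rate_pos: "0 < rate L u"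
  unfolding rate_def using L angle_pos u ratio_pos sin_u_pos by (intro mult_pos_pos divide_pos_pos zero_less_power sin_pos_le_one) auto

lemma ratio_eq: "ratio L u = cos (u / L) - cot u * sin (u / L)"
  using sin_u_pos by (simp add: ratio_def sin_diff cot_def field_simps)

lemma ratio_le_exp: "ratio L u \<le> exp (- (cot u * sin (u / L)))"
proof -
  have "ratio L u \<le> 1 + - (cot u * sin (u / L))" by (simp add: ratio_eq)
  also have "\<dots> \<le> exp (- (cot u * sin (u / L)))" by (rule exp_ge_add_one_self)
  finally show ?thesis .
qed

lemma ratio_le_one: "ratio L u \<le> 1"
proof -
  have "0 \<le> cot u * sin (u / L)"
    using cot_nonneg_le_one[OF u] sin_pos_le_one[of "u / L"] angle_pos u by auto
  then show ?thesis using ratio_le_exp by (auto intro: order_trans)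
qed

lemma u_cot_le_one: "u * cot u \<le> 1"
  using x_cot_le[OF u] by (rule order_trans) simp

lemma ratio_ge: "1 - 2 / L \<le> ratio L u"
proof -
  note uc = u_cot_le_one
  have "cot u * sin (u / L) \<le> cot u * (u / L)"
    using cot_nonneg_le_one[OF u] sin_x_le_x[of "u / L"] angle_pos by (intro mult_left_mono) auto
  also have "\<dots> \<le> 1 / L"
    using uc L by (simp add: field_simps)
  finally have 1: "cot u * sin (u / L) \<le> 1 / L" .
  have "(u / L)\<^sup>2 \<le> (1 / L)\<^sup>2" using u by (intro power_mono divide_right_mono) auto
  also have "\<dots> \<le> 1 / L" using L by (simp add: power2_eq_square field_simps)
  finally have "1 - 1 / L \<le> cos (u / L)" using cos_ge_quadratic[of "u / L"] angle_pos
    divide_nonneg_nonneg[of 1 "real L"] by linarith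
  with 1 show ?thesis by (simp add: ratio_eq)
qed

text \<open>Imaginary part of \<open>\<zeta>^x - \<zeta>^(x+1) = c \<zeta>^(x+1-L)\<close>, rotated
  by \<psi>; this is the eigenvalue equation multiplied by a power of \<zeta>.\<close>

lemma wave_diff: "wave L u \<psi> i - wave L u \<psi> (i + 1) = rate L u * wave L u \<psi> (i + 1 - L)"
proof -
  define \<phi> where "\<phi> = u / L"
  define a where "a = \<phi> * i + \<psi>"
  have uL: "\<phi> * L = u" using L by (simp add: \<phi>_def)
  have r: "ratio L u \<noteq> 0" using ratio_pos by simp
  \<comment> \<open>Division by \<open>sin u\<close> turns the left-hand side into
    \<open>sin a - ratio L u * sin (a + \<phi>)\<close>, the oscillating part of the
    difference.\<close>
  have trig: "sin a * sin u - sin (u - \<phi>) * sin (a + \<phi>) = sin \<phi> * sin (a + \<phi> - u)"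
  proof -
    have "sin \<phi> * sin \<phi> = 1 - cos \<phi> * cos \<phi>" 
      by (metis sin_cos_squared_add3 add.commute add_diff_cancel_right' eq_diff_eq)
    then have "sin \<phi> * (sin \<phi> * sin u * sin a) = (1 - cos \<phi> * cos \<phi>) * (sin u * sin a)"
      by (metis mult.assoc)
    then show ?thesis by (simp add: sin_diff sin_add cos_add cos_diff algebra_simps)
  qed
  have A: "\<phi> * real_of_int (i + 1) + \<psi> = a + \<phi>" "\<phi> * real_of_int (i + 1 - L) + \<psi> = a + \<phi> - u"
    using uL by (auto simp: a_def algebra_simps)
  have P: "ratio L u powi (i + 1) = ratio L u powi i * ratio L u"
    using r by (simp add: power_int_add_1)
  have "ratio L u ^ (L - 1) * ratio L u powi (i + 1 - L) = ratio L u powi (int (L - 1)) * ratio L u powi (i + 1 - L)"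
    by (simp add: power_int_def)
  also have "\<dots> = ratio L u powi i"
    using r L by (subst power_int_add[symmetric]) (auto simp: of_nat_diff)
  finally have P2: "ratio L u ^ (L - 1) * ratio L u powi (i + 1 - L) = ratio L u powi i" .
  have "rate L u * wave L u \<psi> (i + 1 - L) = sin \<phi> / sin u * (ratio L u ^ (L - 1) * ratio L u powi (i + 1 - L)) * sin (a + \<phi> - u)"
    unfolding wave_def rate_def \<phi>_def[symmetric] A by simp
  also have "\<dots> = ratio L u powi i * ((sin \<phi> * sin (a + \<phi> - u)) / sin u)"
    unfolding P2 by simp
  also have "\<dots> = ratio L u powi i * (sin a - ratio L u * sin (a + \<phi>))"
    unfolding trig[symmetric] using sin_u_pos by (simp add: ratio_def \<phi>_def[symmetric] field_simps)
  also have "\<dots> = wave L u \<psi> i - wave L u \<psi> (i + 1)"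
    unfolding wave_def \<phi>_def[symmetric] A P by (simp add: a_def algebra_simps)
  finally show ?thesis by simp
qed

lemma wave_telescope:
  "wave L u \<psi> x = wave L u \<psi> (x + int k) + rate L u * (\<Sum>i<k. wave L u \<psi> (x + int i + 1 - L))"
proof (induction k)
  case (Suc k)
  then show ?case using wave_diff[of \<psi> "x + int k"] by (simp add: algebra_simps)
qed simp

text \<open>Steps from \<open>x\<close> reach every height above \<open>x - L\<close>. Cutting the
  sum off at \<open>M - L\<close> leaves the boundary term \<open>wave L u \<psi> M\<close>, whose
  sign decides between supersolution and subsolution: it is nonnegative in the upper bound and zero
  in the lower one.\<close>

lemma wave_telescope':
  assumes "x \<le> M"
  shows "wave L u \<psi> x = wave L u \<psi> M + rate L u * (\<Sum>y\<in>{x + 1 - int L..M - int L}. wave L u \<psi> y)"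
proof -
  have "(\<Sum>i<nat (M - x). wave L u \<psi> (x + int i + 1 - L)) = (\<Sum>y\<in>{x + 1 - int L..M - int L}. wave L u \<psi> y)"
    using assms
    by (intro sum.reindex_bij_witness[of _ "\<lambda>y. nat (y - x - 1 + L)" "\<lambda>i. x + int i + 1 - L"]) auto
  then show ?thesis using wave_telescope[of \<psi> x "nat (M - x)"] assms by simp
qed

text \<open>The first two factors are the limit for large \<open>L\<close>. In the exponent,
  \<open>(L - 1) * sin (u / L)\<close> falls short of \<open>u\<close> by at most
  \<open>2 * u / L\<close>, and \<open>u * cot u \<le> 1\<close> converts this into the correction
  \<open>exp (2 / L)\<close>.\<close>

lemma rate_le: "L * rate L u \<le> u / sin u * exp (- (u * cot u)) * exp (2 / L)"
proof -
  define \<phi> where "\<phi> = u / L"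
  have \<phi>: "0 < \<phi>" "\<phi> \<le> 1" "\<phi> * L = u" using angle_pos L by (simp_all add: \<phi>_def)
  have ct: "0 \<le> cot u" by (rule cot_nonneg_le_one[OF u])
  have "ratio L u ^ (L - 1) \<le> exp (- (cot u * sin \<phi>)) ^ (L - 1)"
    using ratio_le_exp ratio_pos by (intro power_mono) (auto simp: \<phi>_def)
  also have "\<dots> = exp (- ((L - 1) * sin \<phi> * cot u))"
    by (simp add: exp_of_nat_mult[symmetric] algebra_simps)
  also have "\<dots> \<le> exp (- (u * cot u) + 2 / L)"
  proof -
    have "(L - 1) * (\<phi> - \<phi> ^ 3 / 6) \<le> (L - 1) * sin \<phi>"
      using sin_ge_cubic[of \<phi>] \<phi> by (intro mult_left_mono) auto
    moreover have "(L - 1) * (\<phi> - \<phi> ^ 3 / 6) = u - \<phi> - (u - \<phi>) * \<phi>\<^sup>2 / 6"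
      unfolding \<phi>(3)[symmetric] using L by (simp add: of_nat_diff algebra_simps power2_eq_square power3_eq_cube)
    moreover have "(u - \<phi>) * \<phi>\<^sup>2 \<le> 1 * \<phi>"
    proof -
      have "\<phi>\<^sup>2 \<le> \<phi>" using \<phi> by (simp add: power2_eq_square mult_left_le)
      moreover have "u - \<phi> \<le> 1" using \<phi> u by simp
      ultimately show ?thesis using \<phi> u by (intro mult_mono) auto
    qed
    ultimately have "u - 2 * \<phi> \<le> (L - 1) * sin \<phi>" using \<phi> by linarith
    then have "(u - 2 * \<phi>) * cot u \<le> (L - 1) * sin \<phi> * cot u" using ct by (rule mult_right_mono)
    moreover have "\<phi> * cot u \<le> 1 / L" using u_cot_le_one L by (simp add: \<phi>_def field_simps)
    ultimately show ?thesis by (simp add: algebra_simps)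
  qed
  finally have 1: "ratio L u ^ (L - 1) \<le> exp (- (u * cot u)) * exp (2 / L)" by (simp only: exp_add)
  have 2: "L * sin \<phi> \<le> u"
    using sin_x_le_x[of \<phi>] \<phi> by (metis less_imp_le mult_left_mono of_nat_0_le_iff mult.commute)
  have "L * rate L u = (L * sin \<phi>) / sin u * ratio L u ^ (L - 1)"
    by (simp add: rate_def \<phi>_def)
  also have "\<dots> \<le> u / sin u * (exp (- (u * cot u)) * exp (2 / L))"
    using sin_u_pos 1 2 u ratio_pos
    by (intro mult_mono divide_right_mono) auto
  finally show ?thesis by simp
qed

lemma u_div_sin_le: "u / sin u \<le> exp (u\<^sup>2 / 3)"
proof -
  have u2: "u\<^sup>2 \<le> 1" using u by (simp add: power_le_one)
  have "exp (-2 * (u\<^sup>2 / 6)) \<le> 1 - u\<^sup>2 / 6"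
  proof -
    have "- (u\<^sup>2/6) - 2 * (u\<^sup>2/6)\<^sup>2 \<le> ln (1 - u\<^sup>2 / 6)"
      using u2 by (intro ln_one_minus_pos_lower_bound) auto
    moreover have "2 * (u\<^sup>2/6)\<^sup>2 \<le> u\<^sup>2 / 6"
      using mult_right_mono[OF u2, of "u\<^sup>2"] zero_le_power2[of u]
      unfolding power2_eq_square[of "u\<^sup>2/6"] by linarith
    ultimately have "-2 * (u\<^sup>2 / 6) \<le> ln (1 - u\<^sup>2 / 6)" by linarith
    then show ?thesis using u2 by (subst (asm) ln_ge_iff) auto
  qed
  then have "u * exp (-(u\<^sup>2 / 3)) \<le> u * (1 - u\<^sup>2 / 6)" using u by (intro mult_left_mono) auto
  also have "\<dots> \<le> sin u" using sin_ge_cubic[of u] u by (simp add: power2_eq_square power3_eq_cube algebra_simps)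
  finally show ?thesis using sin_u_pos by (simp add: exp_minus field_simps)
qed

lemma rate_le': "L * rate L u \<le> exp (-1) * exp (u\<^sup>2 + 2 / L)"
proof -
  have "L * rate L u \<le> u / sin u * exp (- (u * cot u)) * exp (2 / L)" by (rule rate_le)
  also have "\<dots> \<le> exp (u\<^sup>2 / 3) * exp (- (1 - u\<^sup>2 / 2)) * exp (2 / L)"
    using u_div_sin_le x_cot_ge[OF u] sin_u_pos u by (intro mult_mono) auto
  also have "\<dots> = exp (-1 + (u\<^sup>2 * 5 / 6 + 2 / L))" by (simp add: exp_add[symmetric] algebra_simps)
  also have "\<dots> \<le> exp (-1 + (u\<^sup>2 + 2 / L))" by simp
  finally show ?thesis by (simp only: exp_add)
qed

lemma rate_le_2: "L * rate L u \<le> 2"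
proof -
  have "L * rate L u = (L * sin (u / L)) / sin u * ratio L u ^ (L - 1)" by (simp add: rate_def)
  also have "\<dots> \<le> u / sin u * 1"
  proof (intro mult_mono divide_right_mono)
    have "L * sin (u / L) \<le> L * (u / L)" using sin_x_le_x[of "u / L"] angle_pos by (intro mult_left_mono) auto
    then show "L * sin (u / L) \<le> u" using L by simp
  qed (use sin_u_pos u ratio_pos ratio_le_one in \<open>auto intro: power_le_one\<close>)
  also have "\<dots> \<le> 2"
  proof -
    have "u ^ 3 \<le> u" using u by (metis less_imp_le power_decreasing power_one_right le_numeral_extra(4) one_le_numeral)
    then have "u / 2 \<le> sin u" using sin_ge_cubic[of u] u by simp
    then show ?thesis using sin_u_pos by (simp add: field_simps)
  qed
  finally show ?thesis .
qed

text \<open>This is the price of climbing down \<open>m\<close> blocks of \<open>L\<close> heights: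
  the sine of \<open>u / L\<close> is at least 5/6 of its argument and
  \<open>u * cot u \<ge> 1 / 2\<close>, so a block contributes at least 5/12 to the
  exponent.\<close>

lemma ratio_power_le: "ratio L u ^ (m * L) \<le> exp (- (m / 3))"
proof -
  define \<phi> where "\<phi> = u / L"
  have \<phi>: "0 < \<phi>" "\<phi> \<le> 1" "\<phi> * L = u" using angle_pos L by (simp_all add: \<phi>_def)
  have ct: "0 \<le> cot u" by (rule cot_nonneg_le_one[OF u])
  have "\<phi> ^ 3 \<le> \<phi>" using \<phi> by (metis less_imp_le power_decreasing power_one_right le_numeral_extra(4) one_le_numeral)
  then have "5 / 6 * \<phi> \<le> sin \<phi>" using sin_ge_cubic[of \<phi>] \<phi> by simp
  then have "L * (5 / 6 * \<phi>) \<le> L * sin \<phi>" by (rule mult_left_mono) auto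
  then have "5 / 6 * u \<le> L * sin \<phi>" unfolding \<phi>(3)[symmetric] by (simp add: algebra_simps)
  then have "5 / 6 * u * cot u \<le> L * sin \<phi> * cot u" using ct by (rule mult_right_mono)
  moreover have "u\<^sup>2 \<le> 1" using u by (simp add: power_le_one)
  ultimately have "1 / 3 \<le> L * sin \<phi> * cot u" using x_cot_ge[OF u] by linarith
  then have 1: "m * (1 / 3) \<le> m * (L * sin \<phi> * cot u)" by (rule mult_left_mono) auto
  have "ratio L u ^ (m * L) \<le> exp (- (cot u * sin \<phi>)) ^ (m * L)"
    using ratio_le_exp ratio_pos by (intro power_mono) (auto simp: \<phi>_def)
  also have "\<dots> = exp (- (m * (L * sin \<phi> * cot u)))"
    by (simp add: exp_of_nat_mult[symmetric] algebra_simps)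
  also have "\<dots> \<le> exp (- (m / 3))" using 1 by simp
  finally show ?thesis .
qed

text \<open>From \<open>ratio L u \<ge> 1 - 2 / L \<ge> exp (- (4 / L))\<close>. It keeps the
  eigenfunction from being too small at the top of the search band.\<close>

lemma ratio_power_ge: "4 \<le> L \<Longrightarrow> exp (- (4 * m)) \<le> ratio L u ^ (m * L)"
proof -
  assume L4: "4 \<le> L"
  have "- (2 / L) - 2 * (2 / L)\<^sup>2 \<le> ln (1 - 2 / L)"
    using L4 by (intro ln_one_minus_pos_lower_bound) (auto simp: field_simps)
  moreover have "2 * (2 / real L)\<^sup>2 \<le> 2 / L" using L4 by (simp add: power2_eq_square field_simps)
  ultimately have "- (4 / L) \<le> ln (1 - 2 / L)" by (simp add: field_simps)
  then have "exp (- (4 / L)) \<le> 1 - 2 / L" using L4 by (subst (asm) ln_ge_iff) (auto simp: field_simps)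
  also have "\<dots> \<le> ratio L u" by (rule ratio_ge)
  finally have "exp (- (4 / L)) ^ (m * L) \<le> ratio L u ^ (m * L)" by (intro power_mono) auto
  then show ?thesis using L by (simp add: exp_of_nat_mult[symmetric] mult.commute)
qed

end

lemma rate_limit:
  fixes u a s :: real assumes "0 < u" "0 < a" "0 < s"
  shows "(\<lambda>L::nat. (real L - 1) * (sin (u / L) / s) * exp ((real L - 1) * ln (cos (u / L) - a * sin (u / L))))
     \<longlonglongrightarrow> u / s * exp (- (u * a))"
proof (intro tendsto_mult tendsto_exp)
  show "(\<lambda>L::nat. (real L - 1) * (sin (u / L) / s)) \<longlonglongrightarrow> u / s"
    using assms by (real_asymp simp: divide_inverse)
  show "(\<lambda>L::nat. (real L - 1) * ln (cos (u / L) - a * sin (u / L))) \<longlonglongrightarrow> - (u * a)"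
    using assms by real_asymp
qed

text \<open>The limit is at least \<open>exp (-1) * exp (u^2 / 4)\<close>; lowering 1/4 to 1/5
  leaves room for a finite \<open>L\<close>. The factor is \<open>L - 1\<close> because a descent
  step in cell \<open>j\<close> changes the height by \<open>j - (L - 1)\<close>.\<close>

lemma rate_eventually_ge:
  fixes u :: real assumes u: "0 < u" "u \<le> 1"
  shows "\<exists>L\<ge>2. exp (-1) * (1 + u\<^sup>2 / 5) \<le> (real L - 1) * rate L u"
proof -
  have s: "0 < sin u" using u by (rule sin_pos_le_one)
  have lim: "(\<lambda>L::nat. (real L - 1) * (sin (u / L) / sin u) * exp ((real L - 1) * ln (cos (u / L) - cot u * sin (u / L))))
     \<longlonglongrightarrow> u / sin u * exp (- (u * cot u))"
    using u(1) cot_gt_zero[of u] u(2) pi_gt3 s by (intro rate_limit) auto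
  have "exp (-1) * (1 + u\<^sup>2 / 5) < 1 * (exp (-1) * exp (u\<^sup>2 / 4))"
  proof -
    have "1 + u\<^sup>2 / 5 < 1 + u\<^sup>2 / 4" using u by simp
    also have "\<dots> \<le> exp (u\<^sup>2 / 4)" by (rule exp_ge_add_one_self)
    finally show ?thesis by simp
  qed
  also have "\<dots> = 1 * exp (- (1 - u\<^sup>2 / 4))" by (simp add: exp_add[symmetric])
  also have "\<dots> \<le> u / sin u * exp (- (u * cot u))"
    using x_cot_le[OF u] sin_x_le_x[of u] u s by (intro mult_mono) auto
  finally have "eventually (\<lambda>L::nat. exp (-1) * (1 + u\<^sup>2 / 5) < (real L - 1) * (sin (u / L) / sin u) * exp ((real L - 1) * ln (cos (u / L) - cot u * sin (u / L)))) sequentially"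
    by (rule order_tendstoD(1)[OF lim])
  moreover have "eventually (\<lambda>L::nat. 2 \<le> L) sequentially" by (rule eventually_ge_at_top)
  ultimately obtain L :: nat where L: "2 \<le> L" 
    and 1: "exp (-1) * (1 + u\<^sup>2 / 5) < (real L - 1) * (sin (u / L) / sin u) * exp ((real L - 1) * ln (cos (u / L) - cot u * sin (u / L)))"
    by (metis (mono_tags, lifting) eventually_conj eventually_sequentially order_refl)
  have "exp ((real L - 1) * ln (ratio L u)) = ratio L u ^ (L - 1)"
    using L ratio_pos[OF L u] by (metis exp_ln exp_of_nat_mult of_nat_diff of_nat_1 one_le_numeral order_trans)
  then show ?thesis using 1 L by (intro exI[of _ L]) (simp add: rate_def ratio_eq[OF L u])
qed

section \<open>Counting descents\<close>

definition weight_law :: "nat \<Rightarrow> real measure" where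
  "weight_law n = density lborel (exponential_density (1 / real n))"

lemma weight_space_eq: "weight_space n = PiM (edges n) (\<lambda>_. weight_law n)"
  by (simp add: weight_space_def weight_law_def)

lemma space_weight_law [simp]: "space (weight_law n) = UNIV"
  and sets_weight_law [measurable_cong, simp]: "sets (weight_law n) = sets borel"
  by (simp_all add: weight_law_def)

lemma prob_space_weight_law: "0 < n \<Longrightarrow> prob_space (weight_law n)"
  unfolding weight_law_def by (rule prob_space_exponential_density) simp

lemma finite_edges [simp]: "finite (edges n)"
proof (rule finite_subset)
  show "edges n \<subseteq> Pow {..<n}" by (auto simp: edges_def)
qed simp

lemma product_prob_space_weight: "0 < n \<Longrightarrow> product_prob_space (\<lambda>_. weight_law n)"
  by (intro product_prob_spaceI prob_space_weight_law)

lemma prob_space_weight_space: "0 < n \<Longrightarrow> prob_space (weight_space n)"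
  unfolding weight_space_eq by (intro prob_space_PiM prob_space_weight_law)

lemma weight_component_measurable [measurable]:
  "e \<in> edges n \<Longrightarrow> (\<lambda>W. W e) \<in> borel_measurable (weight_space n)"
  using measurable_component_singleton[of e "edges n" "\<lambda>_. weight_law n"]
  by (simp add: weight_space_eq measurable_def)

lemma emeasure_weight_law_interval:
  assumes "0 < n" "0 \<le> a" "a \<le> b"
  shows "emeasure (weight_law n) {a..<b} \<le> (b - a) / n"
proof -
  have "emeasure (weight_law n) {a..<b} = (\<integral>\<^sup>+x. ennreal (exponential_density (1 / real n) x) * indicator {a..<b} x \<partial>lborel)"
    unfolding weight_law_def by (subst emeasure_density) auto
  also have "\<dots> \<le> (\<integral>\<^sup>+x. ennreal (1 / n) * indicator {a..<b} x \<partial>lborel)"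
    using assms by (intro nn_integral_mono mult_right_mono ennreal_leI)
      (auto simp: exponential_density_def divide_simps)
  also have "\<dots> = ennreal ((b - a) / n)"
    using assms by (simp add: nn_integral_cmult_indicator ennreal_mult'[symmetric] mult.commute)
  finally show ?thesis .
qed

lemma AE_weight_nonneg:
  assumes "0 < n"
  shows "AE W in weight_space n. \<forall>e\<in>edges n. 0 \<le> W e"
proof (rule AE_finite_allI)
  fix e assume e: "e \<in> edges n"
  interpret product_prob_space "\<lambda>_. weight_law n" "edges n" by (rule product_prob_space_weight) fact
  have "AE w in weight_law n. 0 \<le> w"
    unfolding weight_law_def by (subst AE_density) (auto simp: exponential_density_def)
  then show "AE W in weight_space n. 0 \<le> W e"
    unfolding weight_space_eq by (rule AE_component[OF e])
qed simp

text \<open>Negative weights, a null event, also fall into cell 0.\<close>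

definition cell :: "real \<Rightarrow> (nat set \<Rightarrow> real) \<Rightarrow> nat set \<Rightarrow> nat" where
  "cell c W e = nat \<lfloor>W e / c\<rfloor>"

lemma cell_measurable [measurable]:
  "e \<in> edges n \<Longrightarrow> (\<lambda>W. cell c W e) \<in> measurable (weight_space n) (count_space UNIV)"
  unfolding cell_def by measurable

text \<open>The density is at most \<open>1 / n\<close> everywhere, so every cell of width
  \<open>c\<close> has mass at most \<open>c / n\<close>. The bound does not depend on
  \<open>J\<close>, which is why a descent will be weighted by its length alone.\<close>

lemma prob_cells_le:
  assumes n: "0 < n" and c: "0 < c" and E: "E \<subseteq> edges n"
  shows "measure (weight_space n) {W \<in> space (weight_space n). \<forall>e\<in>E. cell c W e = J e} \<le> (c / n) ^ card E"
proof -
  interpret product_prob_space "\<lambda>_. weight_law n" "edges n" by (rule product_prob_space_weight) fact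
  interpret W: prob_space "weight_space n" by (rule prob_space_weight_space) fact
  have fin: "finite E" using E finite_edges by (rule finite_subset)
  have one: "emeasure (weight_law n) {w. nat \<lfloor>w / c\<rfloor> = j} \<le> c / n" for j
  proof -
    \<comment> \<open>Cell 0 also contains the negative weights, so it is an interval of length
      \<open>c\<close> only up to a null set.\<close>
    have "emeasure (weight_law n) {w. nat \<lfloor>w / c\<rfloor> = j} = emeasure (weight_law n) {w. nat \<lfloor>w / c\<rfloor> = j \<and> 0 \<le> w}"
    proof (rule emeasure_eq_AE)
      have "AE w in weight_law n. 0 \<le> w"
        unfolding weight_law_def by (subst AE_density) (auto simp: exponential_density_def)
      then show "AE w in weight_law n. (w \<in> {w. nat \<lfloor>w / c\<rfloor> = j}) = (w \<in> {w. nat \<lfloor>w / c\<rfloor> = j \<and> 0 \<le> w})"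
        by eventually_elim auto
    qed measurable
    also have "\<dots> \<le> emeasure (weight_law n) {c * j..<c * (j + 1)}"
    proof (intro emeasure_mono subsetI)
      fix w assume w: "w \<in> {w. nat \<lfloor>w / c\<rfloor> = j \<and> 0 \<le> w}"
      then have "\<lfloor>w / c\<rfloor> = int j" using c by auto
      then have "j \<le> w / c" "w / c < j + 1" by linarith+
      then show "w \<in> {c * j..<c * (j + 1)}" using c by (auto simp: field_simps)
    qed simp
    also have "\<dots> \<le> (c * (j + 1) - c * j) / n"
      using n c by (intro emeasure_weight_law_interval) auto
    finally show ?thesis by (simp add: algebra_simps)
  qed
  have "emeasure (weight_space n) {W \<in> space (weight_space n). \<forall>e\<in>E. cell c W e = J e}
      = emeasure (PiM (edges n) (\<lambda>_. weight_law n)) {W \<in> space (PiM (edges n) (\<lambda>_. weight_law n)). \<forall>e\<in>E. W e \<in> {w. nat \<lfloor>w / c\<rfloor> = J e}}"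
    by (simp add: weight_space_eq cell_def)
  also have "\<dots> = (\<Prod>e\<in>E. emeasure (weight_law n) {w. nat \<lfloor>w / c\<rfloor> = J e})"
    using E fin by (intro emeasure_PiM_Collect) auto
  also have "\<dots> \<le> (\<Prod>e\<in>E. ennreal (c / n))"
    by (intro prod_mono_ennreal one)
  also have "\<dots> = ennreal ((c / n) ^ card E)"
    using c by (simp add: ennreal_power)
  finally show ?thesis using c by (simp add: W.emeasure_eq_measure)
qed

section \<open>Descents and their generating sums\<close>

fun descent :: "nat \<Rightarrow> int \<Rightarrow> int \<Rightarrow> (nat \<times> nat) list \<Rightarrow> bool" where
  "descent L K x [] = (x \<le> - K)"
| "descent L K x ((v, j) # ps) = (- K < x \<and> x < K \<and> descent L K (x + int j + 1 - int L) ps)"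

text \<open>Entries are the next vertex and the cell of the edge leading to it; the start vertex is
  implicit. Vertices may repeat: this only overcounts, and it lets the sum factor step by step. The
  bound \<open>T\<close> makes the set finite and carries the induction.\<close>

definition descents :: "nat \<Rightarrow> nat \<Rightarrow> int \<Rightarrow> nat \<Rightarrow> int \<Rightarrow> (nat \<times> nat) list set" where
  "descents n L K T x = {ps. length ps \<le> T \<and> fst ` set ps \<subseteq> {..<n} \<and> descent L K x ps}"

lemma descents_inner_Suc:
  assumes "- K < x" "x < K"
  shows "descents n L K (Suc T) x =
    (\<lambda>(v, j, ps). (v, j) # ps) `
      (SIGMA v:{..<n}. SIGMA j:{j. x + int j + 1 - int L < K}. descents n L K T (x + int j + 1 - int L))"
  (is "?A = ?B")
proof (intro equalityI subsetI)
  fix ps assume ps: "ps \<in> ?A"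
  obtain v j qs where [simp]: "ps = (v, j) # qs" using ps assms by (cases ps) (auto simp: descents_def)
  have "K > 0" using assms by simp
  then have "x + int j + 1 - int L < K" using ps by (cases qs) (auto simp: descents_def)
  then show "ps \<in> ?B" using ps by (auto simp: descents_def intro!: image_eqI[of _ _ "(v, j, qs)"])
qed (use assms in \<open>fastforce simp: descents_def\<close>)

lemma descents_bottom: "x \<le> - K \<Longrightarrow> descents n L K T x = {[]}"
proof -
  assume x: "x \<le> - K"
  have "ps = []" if "ps \<in> descents n L K T x" for ps
    using that x by (cases ps) (auto simp: descents_def)
  then show ?thesis using x by (auto simp: descents_def)
qed

lemma descents_inner_0: "- K < x \<Longrightarrow> descents n L K 0 x = {}"
  by (auto simp: descents_def)

lemma finite_descents:
  assumes "x < K"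
  shows "finite (descents n L K T x)"
  using assms
proof (induction T arbitrary: x)
  case 0
  then show ?case by (cases "x \<le> - K") (auto simp: descents_bottom descents_inner_0)
next
  case (Suc T)
  have "finite {j. x + int j + 1 - int L < K}"
    by (rule finite_subset[of _ "{..<nat (K - x + int L)}"]) auto
  then show ?case using Suc
    by (cases "x \<le> - K") (auto simp: descents_bottom descents_inner_Suc intro!: finite_imageI finite_SigmaI)
qed

text \<open>First-step analysis: the \<open>n\<close> choices of the next vertex cancel the
  \<open>1 / n\<close>, leaving \<open>c\<close> times the sum over the reachable heights below
  \<open>K\<close>, so any supersolution \<open>H\<close> dominates. The hypothesis
  \<open>bottom\<close> covers \<open>L\<close> heights because the exit step may overshoot
  \<open>- K\<close>.\<close>

lemma sum_descents_le:
  fixes H :: "int \<Rightarrow> real"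
  assumes n: "0 < n" and c: "0 \<le> c"
    and bottom: "\<And>x. - K - int L < x \<Longrightarrow> x \<le> - K \<Longrightarrow> 1 \<le> H x"
    and super: "\<And>x. - K < x \<Longrightarrow> x < K \<Longrightarrow> c * (\<Sum>y\<in>{x + 1 - int L..K - 1}. H y) \<le> H x"
    and nonneg: "\<And>x. - K - int L < x \<Longrightarrow> x < K \<Longrightarrow> 0 \<le> H x"
  shows "- K - int L < x \<Longrightarrow> x < K \<Longrightarrow> (\<Sum>ps\<in>descents n L K T x. (c / n) ^ length ps) \<le> H x"
proof (induction T arbitrary: x)
  case 0
  then show ?case using bottom nonneg by (cases "x \<le> - K") (auto simp: descents_bottom descents_inner_0)
next
  case (Suc T)
  show ?case
  proof (cases "x \<le> - K")
    case True
    then show ?thesis using bottom Suc.prems by (simp add: descents_bottom)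
  next
    case False
    define J where "J = {j. x + int j + 1 - int L < K}"
    have J: "finite J" unfolding J_def
      by (rule finite_subset[of _ "{..<nat (K - x + int L)}"]) auto
    have "(\<Sum>ps\<in>descents n L K (Suc T) x. (c / n) ^ length ps)
       = (\<Sum>(v, j, ps)\<in>(SIGMA v:{..<n}. SIGMA j:J. descents n L K T (x + int j + 1 - int L)). (c / n) ^ Suc (length ps))"
      using False Suc.prems unfolding J_def
      by (subst descents_inner_Suc) (auto simp: sum.reindex inj_on_def case_prod_beta intro!: sum.cong)
    also have "\<dots> = (\<Sum>v<n. \<Sum>j\<in>J. \<Sum>ps\<in>descents n L K T (x + int j + 1 - int L). (c / n) ^ Suc (length ps))"
      using J by (subst sum.Sigma[symmetric], simp, force simp: J_def intro: finite_descents,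
        intro sum.cong refl, subst sum.Sigma[symmetric]) (auto simp: J_def intro: finite_descents)
    also have "\<dots> = (\<Sum>v<n. (c / n) * (\<Sum>j\<in>J. \<Sum>ps\<in>descents n L K T (x + int j + 1 - int L). (c / n) ^ length ps))"
      by (simp add: sum_distrib_left)
    also have "\<dots> = c * (\<Sum>j\<in>J. \<Sum>ps\<in>descents n L K T (x + int j + 1 - int L). (c / n) ^ length ps)"
      using n by simp
    also have "\<dots> \<le> c * (\<Sum>j\<in>J. H (x + int j + 1 - int L))"
      using c Suc.prems False by (intro mult_left_mono sum_mono Suc.IH) (auto simp: J_def)
    also have "(\<Sum>j\<in>J. H (x + int j + 1 - int L)) = (\<Sum>y\<in>{x + 1 - int L..K - 1}. H y)"
      by (rule sum.reindex_bij_witness[of _ "\<lambda>y. nat (y - x - 1 + int L)" "\<lambda>j. x + int j + 1 - int L"])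
        (auto simp: J_def)
    also have "c * \<dots> \<le> H x" using False Suc.prems by (intro super) auto
    finally show ?thesis .
  qed
qed

section \<open>Realization of descents by the weights and the union bound\<close>

fun follows :: "real \<Rightarrow> (nat set \<Rightarrow> real) \<Rightarrow> nat \<Rightarrow> (nat \<times> nat) list \<Rightarrow> bool" where
  "follows c W a [] = True"
| "follows c W a ((v, j) # ps) = (cell c W {a, v} = j \<and> follows c W v ps)"

fun walk_edges :: "nat \<Rightarrow> (nat \<times> nat) list \<Rightarrow> nat set list" where
  "walk_edges a [] = []"
| "walk_edges a ((v, j) # ps) = {a, v} # walk_edges v ps"

lemma length_walk_edges [simp]: "length (walk_edges a ps) = length ps"
  by (induction a ps rule: walk_edges.induct) auto

lemma follows_cell_eq:
  "follows c W a ps \<Longrightarrow> follows c W' a ps \<Longrightarrow> e \<in> set (walk_edges a ps) \<Longrightarrow> cell c W e = cell c W' e"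
  by (induction c W a ps rule: follows.induct) auto

lemma follows_measurable:
  "set (walk_edges a ps) \<subseteq> edges n \<Longrightarrow> Measurable.pred (weight_space n) (\<lambda>W. follows c W a ps)"
proof (induction a ps rule: walk_edges.induct)
  case (2 a v j ps)
  then have [measurable]: "Measurable.pred (weight_space n) (\<lambda>W. follows c W v ps)" "{a, v} \<in> edges n" by auto
  show ?case by simp
qed simp

definition edge_disjoint :: "nat \<Rightarrow> nat set \<Rightarrow> (nat \<Rightarrow> (nat \<times> nat) list) \<Rightarrow> bool" where
  "edge_disjoint n A g \<longleftrightarrow>
    (\<forall>a\<in>A. distinct (walk_edges a (g a)) \<and> set (walk_edges a (g a)) \<subseteq> edges n) \<and>
    disjoint_family_on (\<lambda>a. set (walk_edges a (g a))) A"

text \<open>If some \<open>W0\<close> realizes all lists, the event forces every edge involved into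
  the cell it has under \<open>W0\<close>, and these edges are distinct. If there is no such
  \<open>W0\<close>, the event is empty. Reading the cells off a witness avoids constructing the
  cell assignment from the lists.\<close>

lemma prob_follows_le:
  assumes n: "0 < n" and c: "0 < c" and A: "finite A" and dj: "edge_disjoint n A g"
  shows "measure (weight_space n) {W \<in> space (weight_space n). \<forall>a\<in>A. follows c W a (g a)}
      \<le> (\<Prod>a\<in>A. (c / n) ^ length (g a))"
proof (cases "\<exists>W0 \<in> space (weight_space n). \<forall>a\<in>A. follows c W0 a (g a)")
  case False
  then have "{W \<in> space (weight_space n). \<forall>a\<in>A. follows c W a (g a)} = {}" by auto
  then show ?thesis using c by (simp only: measure_empty) (simp add: prod_nonneg)
next
  case True
  then obtain W0 where W0: "\<forall>a\<in>A. follows c W0 a (g a)" by auto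
  interpret W: prob_space "weight_space n" by (rule prob_space_weight_space) fact
  define E where "E = (\<Union>a\<in>A. set (walk_edges a (g a)))"
  have E: "E \<subseteq> edges n" using dj by (auto simp: E_def edge_disjoint_def)
  have cE: "card E = (\<Sum>a\<in>A. length (g a))"
    using dj A unfolding E_def edge_disjoint_def
    by (subst card_UN_disjoint') (auto simp: distinct_card)
  have "measure (weight_space n) {W \<in> space (weight_space n). \<forall>a\<in>A. follows c W a (g a)}
     \<le> measure (weight_space n) {W \<in> space (weight_space n). \<forall>e\<in>E. cell c W e = cell c W0 e}"
  proof (rule W.finite_measure_mono)
    show "{W \<in> space (weight_space n). \<forall>a\<in>A. follows c W a (g a)}
        \<subseteq> {W \<in> space (weight_space n). \<forall>e\<in>E. cell c W e = cell c W0 e}"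
      using W0 by (auto simp: E_def intro: follows_cell_eq)
    have [measurable]: "Measurable.pred (weight_space n) (\<lambda>W. cell c W e = cell c W0 e)" if "e \<in> E" for e
    proof -
      have [measurable]: "e \<in> edges n" using that E by auto
      show ?thesis by measurable
    qed
    show "{W \<in> space (weight_space n). \<forall>e\<in>E. cell c W e = cell c W0 e} \<in> W.events"
      using E finite_subset[OF E] by measurable
  qed
  also have "\<dots> \<le> (c / n) ^ card E" using n c E by (rule prob_cells_le)
  also have "\<dots> = (\<Prod>a\<in>A. (c / n) ^ length (g a))" by (simp add: cE power_sum)
  finally show ?thesis .
qed

text \<open>Edge-disjointness makes the probabilities multiply. Distinct starting vertices reduce
  the choice of starts to \<open>n choose k\<close>, whose factor \<open>1 / fact k\<close> is
  essential when \<open>k\<close> is linear in \<open>n\<close>.\<close>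

definition many_descents :: "nat \<Rightarrow> real \<Rightarrow> nat \<Rightarrow> int \<Rightarrow> nat \<Rightarrow> (nat set \<Rightarrow> real) set" where
  "many_descents n c L K k = {W \<in> space (weight_space n). \<exists>A g. A \<subseteq> {..<n} \<and> card A = k \<and>
     g \<in> PiE A (\<lambda>_. descents n L K n 0) \<and> edge_disjoint n A g \<and> (\<forall>a\<in>A. follows c W a (g a))}"

lemma many_descents_le:
  fixes q :: real
  assumes n: "0 < n" and c: "0 < c" and K: "0 < K"
    and q: "(\<Sum>ps\<in>descents n L K n 0. (c / n) ^ length ps) \<le> q"
  shows "many_descents n c L K k \<in> sets (weight_space n)"
    and "measure (weight_space n) (many_descents n c L K k) \<le> (n choose k) * q ^ k"
proof -
  interpret W: prob_space "weight_space n" by (rule prob_space_weight_space) fact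
  define D where "D = descents n L K n 0"
  define \<A> where "\<A> = {A. A \<subseteq> {..<n} \<and> card A = k}"
  define \<G> where "\<G> A = {g \<in> PiE A (\<lambda>_. D). edge_disjoint n A g}" for A
  define Ev where "Ev A g = {W \<in> space (weight_space n). \<forall>a\<in>A. follows c W a (g a)}" for A g
  have fD: "finite D" unfolding D_def using K by (intro finite_descents)
  have fA: "finite \<A>" unfolding \<A>_def by (rule finite_subset[of _ "Pow {..<n}"]) auto
  have finA: "finite A" if "A \<in> \<A>" for A using that by (auto simp: \<A>_def intro: finite_subset)
  have fP: "finite (PiE A (\<lambda>_. D))" if "A \<in> \<A>" for A using that fD finA by (intro finite_PiE) auto
  have fG: "finite (\<G> A)" if "A \<in> \<A>" for A using fP[OF that] by (simp add: \<G>_def)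
  have eq: "many_descents n c L K k = (\<Union>A\<in>\<A>. \<Union>g\<in>\<G> A. Ev A g)"
    by (auto simp: many_descents_def \<A>_def \<G>_def Ev_def D_def)
  have mEv: "Ev A g \<in> W.events" if "A \<in> \<A>" "g \<in> \<G> A" for A g
  proof -
    have [measurable]: "Measurable.pred (weight_space n) (\<lambda>W. follows c W a (g a))" if "a \<in> A" for a
      using that \<open>g \<in> \<G> A\<close> by (intro follows_measurable) (auto simp: \<G>_def edge_disjoint_def)
    show ?thesis unfolding Ev_def using finA[OF that(1)] by measurable
  qed
  show "many_descents n c L K k \<in> W.events"
    unfolding eq using fA fG mEv by (intro sets.finite_UN) auto
  have "W.prob (many_descents n c L K k) \<le> (\<Sum>A\<in>\<A>. W.prob (\<Union>g\<in>\<G> A. Ev A g))"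
    unfolding eq using fA fG mEv by (intro W.finite_measure_subadditive_finite) (auto intro!: sets.finite_UN)
  also have "\<dots> \<le> (\<Sum>A\<in>\<A>. \<Sum>g\<in>\<G> A. W.prob (Ev A g))"
    using fG mEv by (intro sum_mono W.finite_measure_subadditive_finite) auto
  also have "\<dots> \<le> (\<Sum>A\<in>\<A>. \<Sum>g\<in>\<G> A. \<Prod>a\<in>A. (c / n) ^ length (g a))"
    unfolding Ev_def using finA by (intro sum_mono prob_follows_le n c) (auto simp: \<G>_def)
  \<comment> \<open>Independence has been used by now; enlarging the sum to all families lets sum
    and product be interchanged.\<close>
  also have "\<dots> \<le> (\<Sum>A\<in>\<A>. \<Sum>g\<in>PiE A (\<lambda>_. D). \<Prod>a\<in>A. (c / n) ^ length (g a))"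
    using fP c by (intro sum_mono sum_mono2) (auto simp: \<G>_def intro!: prod_nonneg)
  also have "\<dots> = (\<Sum>A\<in>\<A>. \<Prod>a\<in>A. \<Sum>ps\<in>D. (c / n) ^ length ps)"
    using fD finA by (intro sum.cong refl prod_sum_PiE[symmetric]) auto
  also have "\<dots> \<le> (\<Sum>A\<in>\<A>. \<Prod>a\<in>A. q)"
    using q c by (intro sum_mono prod_mono) (auto simp: D_def intro!: sum_nonneg)
  also have "\<dots> = (n choose k) * q ^ k"
    using n_subsets[of "{..<n}" k] by (simp add: \<A>_def)
  finally show "W.prob (many_descents n c L K k) \<le> (n choose k) * q ^ k" .
qed

section \<open>Cutting a light path into descents\<close>

text \<open>The path is cut greedily whenever its height has moved by \<open>K\<close>; only the pieces going down are
  recorded. Each of them lowers the height by less than \<open>K + L\<close>, so a large total decrease forces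
  many of them.\<close>

lemma greedy_descents:
  fixes s :: "nat \<Rightarrow> int" and K :: int
  assumes s: "\<And>i. 1 - int L \<le> s i" and K: "0 < K"
  shows "a \<le> m \<Longrightarrow> \<exists>I e. I \<subseteq> {a..<m} \<and>
     (\<forall>i\<in>I. i < e i \<and> e i \<le> m \<and> (\<forall>t\<in>{i..<e i}. - K < sum s {i..<t} \<and> sum s {i..<t} < K) \<and> sum s {i..<e i} \<le> - K) \<and>
     (\<forall>i\<in>I. \<forall>j\<in>I. i < j \<longrightarrow> e i \<le> j) \<and> - sum s {a..<m} < (K + int L) * card I + K"
proof (induction "m - a" arbitrary: a rule: less_induct)
  case less
  let ?P = "\<lambda>b. a < b \<and> b \<le> m \<and> \<not> (- K < sum s {a..<b} \<and> sum s {a..<b} < K)"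
  show ?case
  proof (cases "\<exists>b. ?P b")
    case False
    \<comment> \<open>The last stretch never leaves the band; it accounts for the additive
      \<open>K\<close> in the bound.\<close>
    have "- K < sum s {a..<m}"
      using False less.prems K by (cases "a = m") auto
    then show ?thesis by (intro exI[of _ "{}"]) auto
  next
    case True
    define b where "b = (LEAST b. ?P b)"
    have b: "?P b" unfolding b_def using True by (rule LeastI_ex)
    have band: "- K < sum s {a..<t} \<and> sum s {a..<t} < K" if "t \<in> {a..<b}" for t
    proof (cases "t = a")
      case False
      then show ?thesis using that b not_less_Least[of t ?P] unfolding b_def[symmetric] by auto
    qed (use K in simp)
    have sp: "sum s {a..<m} = sum s {a..<b} + sum s {b..<m}"
      using b by (intro sum.atLeastLessThan_concat[symmetric]) auto
    have "m - b < m - a" "b \<le> m" using b by auto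
    from less.hyps[OF this] obtain I e where I: "I \<subseteq> {b..<m}"
      "\<forall>i\<in>I. i < e i \<and> e i \<le> m \<and> (\<forall>t\<in>{i..<e i}. - K < sum s {i..<t} \<and> sum s {i..<t} < K) \<and> sum s {i..<e i} \<le> - K"
      "\<forall>i\<in>I. \<forall>j\<in>I. i < j \<longrightarrow> e i \<le> j" "- sum s {b..<m} < (K + int L) * card I + K"
      by (elim exE conjE) (rule that; assumption)
    have aI: "a \<notin> I" and finI: "finite I" using I(1) b by (auto intro: finite_subset)
    show ?thesis
    proof (cases "K \<le> sum s {a..<b}")
      \<comment> \<open>A piece leaving the band at the top raises the height, so discarding it only
        strengthens the estimate.\<close>
      case True
      then show ?thesis using I b K sp by (intro exI[of _ I] exI[of _ e]) auto
    next
      case False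
      then have low: "sum s {a..<b} \<le> - K" using b by linarith
      have "sum s {a..<b} = sum s {a..<b - 1} + s (b - 1)"
        using b sum.atLeastLessThan_Suc[of a "b - 1" s] by auto
      moreover have "- K < sum s {a..<b - 1}" using band[of "b - 1"] b by auto
      ultimately have drop: "- sum s {a..<b} < K + int L" using s[of "b - 1"] by linarith
      have c: "(K + int L) * card (insert a I) = (K + int L) * card I + (K + int L)"
        using aI finI by (simp add: algebra_simps)
      show ?thesis
      proof (intro exI[of _ "insert a I"] exI[of _ "e(a := b)"] conjI)
        show "insert a I \<subseteq> {a..<m}" using I(1) b by auto
        show "- sum s {a..<m} < (K + int L) * card (insert a I) + K"
          unfolding c using I(4) drop sp by linarith
        show "\<forall>i\<in>insert a I. \<forall>j\<in>insert a I. i < j \<longrightarrow> (e(a := b)) i \<le> j"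
        proof (intro ballI impI)
          fix i j assume ij: "i \<in> insert a I" "j \<in> insert a I" "i < j"
          then have "j \<in> I" using I(1) b by auto
          then show "(e(a := b)) i \<le> j" using ij I(1,3) aI by (cases "i = a") auto
        qed
        show "\<forall>i\<in>insert a I. i < (e(a := b)) i \<and> (e(a := b)) i \<le> m \<and>
            (\<forall>t\<in>{i..<(e(a := b)) i}. - K < sum s {i..<t} \<and> sum s {i..<t} < K) \<and> sum s {i..<(e(a := b)) i} \<le> - K"
          using I(2) b low band aI by auto
      qed
    qed
  qed
qed

lemma descent_map:
  assumes "a \<le> b" and "\<And>l. s l = int (j l) + 1 - int L"
    and "\<And>t. t \<in> {a..<b} \<Longrightarrow> - K < x + sum s {a..<t} \<and> x + sum s {a..<t} < K"
    and "x + sum s {a..<b} \<le> - K"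
  shows "descent L K x (map (\<lambda>l. (f l, j l)) [a..<b])"
  using assms(1,3,4)
proof (induction a arbitrary: x rule: inc_induct)
  case (step a)
  have sum: "sum s {a..<t} = s a + sum s {Suc a..<t}" if "a < t" for t
    using that by (simp add: sum.atLeast_Suc_lessThan)
  have "descent L K (x + s a) (map (\<lambda>l. (f l, j l)) [Suc a..<b])"
  proof (rule step.IH)
    fix t assume "t \<in> {Suc a..<b}"
    then show "- K < x + s a + sum s {Suc a..<t} \<and> x + s a + sum s {Suc a..<t} < K"
      using step.prems(1)[of t] sum[of t] by auto
  qed (use step.prems(2) step.hyps sum[of b] in auto)
  then show ?case using step.hyps step.prems(1)[of a]
    by (simp add: upt_conv_Cons assms(2) algebra_simps)
qed simp

lemma follows_map:
  assumes "a \<le> b"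
  shows "follows c W (y a) (map (\<lambda>l. (y (Suc l), cell c W {y l, y (Suc l)})) [a..<b])"
  using assms by (induction a rule: inc_induct) (auto simp: upt_conv_Cons)

lemma walk_edges_map:
  assumes "a \<le> b"
  shows "walk_edges (y a) (map (\<lambda>l. (y (Suc l), j l)) [a..<b]) = map (\<lambda>l. {y l, y (Suc l)}) [a..<b]"
  using assms by (induction a rule: inc_induct) (auto simp: upt_conv_Cons)

lemma path_edge_in_edges:
  "is_path n xs \<Longrightarrow> i < path_len xs \<Longrightarrow> {xs ! i, xs ! Suc i} \<in> edges n"
  unfolding is_path_def path_len_def edges_def mem_Collect_eq
  by (intro exI[of _ "xs ! i"] exI[of _ "xs ! Suc i"]) (auto simp: nth_eq_iff_index_eq subset_iff)

lemma path_edges_inj: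
  "is_path n xs \<Longrightarrow> inj_on (\<lambda>i. {xs ! i, xs ! Suc i}) {..<path_len xs}"
  unfolding is_path_def path_len_def inj_on_def
  by (auto simp: doubleton_eq_iff nth_eq_iff_index_eq)

lemma path_len_le: "is_path n xs \<Longrightarrow> path_len xs \<le> n"
  unfolding is_path_def path_len_def
  using card_mono[of "{..<n}" "set xs"] by (auto simp: distinct_card)

text \<open>Rounded down, the cells average at most \<open>lam / c\<close>, so the height falls by
  at least \<open>(real L - 1) - lam / c\<close> per edge on average; division by the largest loss
  \<open>K + L\<close> of one piece gives \<open>k\<close>. Distinct path vertices give distinct
  starts, and disjoint index intervals give disjoint edges.\<close>

lemma light_path_many_descents:
  assumes c: "0 < c" and L: "1 \<le> L" and K: "0 < K"
    and W: "W \<in> space (weight_space n)" "\<forall>e\<in>edges n. 0 \<le> W e"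
    and xs: "is_path n xs" "avg_weight W xs \<le> lam"
    and k: "(real_of_int K + L) * k \<le> path_len xs * ((real L - 1) - lam / c)"
  shows "W \<in> many_descents n c L K k"
proof -
  define M where "M = path_len xs"
  define y where "y i = xs ! i" for i
  define j where "j l = cell c W {y l, y (Suc l)}" for l
  define s where "s l = int (j l) + 1 - int L" for l
  have M: "0 < M" "M \<le> n" using xs(1) path_len_le[OF xs(1)] by (auto simp: M_def is_path_def path_len_def)
  have jc: "j l * c \<le> W {y l, y (Suc l)}" if "l < M" for l
  proof -
    have "0 \<le> W {y l, y (Suc l)}"
      using W(2) path_edge_in_edges[OF xs(1)] that by (auto simp: M_def y_def)
    then have "0 \<le> W {y l, y (Suc l)} / c" using c by simp
    then have "j l \<le> W {y l, y (Suc l)} / c" unfolding j_def cell_def by linarith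
    then show ?thesis using c by (simp add: field_simps)
  qed
  have "(\<Sum>l<M. real (j l)) * c \<le> (\<Sum>l<M. W {y l, y (Suc l)})"
    unfolding sum_distrib_right using jc by (intro sum_mono) auto
  also have "\<dots> \<le> lam * M"
    using xs(2) M by (simp add: avg_weight_def M_def[symmetric] y_def field_simps)
  finally have "(\<Sum>l<M. real (j l)) \<le> M * (lam / c)" using c by (simp add: field_simps)
  then have "M * ((real L - 1) - lam / c) \<le> - real_of_int (sum s {0..<M})"
    by (simp add: s_def sum.distrib sum_subtractf algebra_simps atLeast0LessThan)
  then have ks: "(real_of_int K + L) * k \<le> - real_of_int (sum s {0..<M})"
    using k by (simp add: M_def)
  have s_ge: "1 - int L \<le> s i" for i by (simp add: s_def)
  obtain I e where I: "I \<subseteq> {0..<M}"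
    "\<forall>i\<in>I. i < e i \<and> e i \<le> M \<and> (\<forall>t\<in>{i..<e i}. - K < sum s {i..<t} \<and> sum s {i..<t} < K) \<and> sum s {i..<e i} \<le> - K"
    "\<forall>i\<in>I. \<forall>j\<in>I. i < j \<longrightarrow> e i \<le> j" "- sum s {0..<M} < (K + int L) * card I + K"
    using greedy_descents[of L s, OF s_ge K, of 0 M] by (metis le0)
  \<comment> \<open>The remainder \<open>K\<close> is absorbed as one further \<open>K + L\<close>;
    the strict inequality \<open>k < card I + 1\<close> then suffices.\<close>
  have "k \<le> card I"
  proof -
    have "real_of_int (- sum s {0..<M}) < real_of_int ((K + int L) * card I + K)"
      using I(4) by (simp only: of_int_less_iff)
    then have "(real_of_int K + L) * k < (real_of_int K + L) * card I + K"
      using ks by simp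
    also have "\<dots> \<le> (real_of_int K + L) * (card I + 1)" using L by (simp add: algebra_simps)
    finally have "real k < card I + 1"
      using K L by (subst (asm) mult_less_cancel_left_pos) auto
    then show ?thesis by simp
  qed
  then obtain I' where I': "I' \<subseteq> I" "card I' = k" by (metis obtain_subset_with_card_n)
  define ps where "ps i = map (\<lambda>l. (y (Suc l), j l)) [i..<e i]" for i
  have inj: "inj_on y I'"
  proof (rule inj_onI)
    fix i i' assume "i \<in> I'" "i' \<in> I'" "y i = y i'"
    moreover have "i < length xs" if "i \<in> I'" for i
      using that I' I(1) by (force simp: M_def path_len_def)
    ultimately show "i = i'" using xs(1) by (simp add: y_def is_path_def nth_eq_iff_index_eq)
  qed
  define g where "g = (\<lambda>a\<in>y ` I'. ps (the_inv_into I' y a))"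
  have g: "g (y i) = ps i" if "i \<in> I'" for i
    using that inj by (simp add: g_def the_inv_into_f_f)
  have yn: "y i < n" if "i \<le> M" for i
    using that xs(1) M by (auto simp: y_def is_path_def M_def path_len_def subset_iff)
  have we: "walk_edges (y i) (ps i) = map (\<lambda>l. {y l, y (Suc l)}) [i..<e i]" if "i \<in> I'" for i
    unfolding ps_def using I(2) I' that by (intro walk_edges_map) (meson less_imp_le subsetD)
  have einj: "inj_on (\<lambda>l. {y l, y (Suc l)}) {..<M}"
    unfolding y_def M_def by (rule path_edges_inj[OF xs(1)])
  show ?thesis
    unfolding many_descents_def
  proof (intro CollectI conjI exI[of _ "y ` I'"] exI[of _ g])
    show "y ` I' \<subseteq> {..<n}" using yn I(1) I' by (force simp: less_imp_le)
    show "card (y ` I') = k" using inj I' by (simp add: card_image)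
    show "g \<in> y ` I' \<rightarrow>\<^sub>E descents n L K n 0"
    proof (rule PiE_I)
      fix a assume "a \<in> y ` I'"
      then obtain i where i: "i \<in> I'" "a = y i" by auto
      then have e: "i < e i \<and> e i \<le> M \<and> (\<forall>t\<in>{i..<e i}. - K < sum s {i..<t} \<and> sum s {i..<t} < K) \<and> sum s {i..<e i} \<le> - K"
        using I(2) I' by auto
      then have "descent L K 0 (ps i)"
        unfolding ps_def by (intro descent_map[of _ _ s]) (auto simp: s_def)
      then show "g a \<in> descents n L K n 0"
        using i g e M yn by (auto simp: descents_def ps_def)
    qed (auto simp: g_def)
    show "edge_disjoint n (y ` I') g"
      unfolding edge_disjoint_def
    proof (intro conjI ballI)
      fix a assume "a \<in> y ` I'"
      then obtain i where i: "i \<in> I'" "a = y i" by auto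
      then have e: "i < e i" "e i \<le> M" using I(2) I' by auto
      show "distinct (walk_edges a (g a))"
        using i e by (simp add: g we distinct_map) (rule inj_on_subset[OF einj], auto)
      show "set (walk_edges a (g a)) \<subseteq> edges n"
        using i e path_edge_in_edges[OF xs(1)] by (simp add: g we) (auto simp: M_def y_def)
    next
      show "disjoint_family_on (\<lambda>a. set (walk_edges a (g a))) (y ` I')"
        unfolding disjoint_family_on_def
      proof safe
        fix i i' a assume *: "i \<in> I'" "i' \<in> I'" "y i \<noteq> y i'"
          "a \<in> set (walk_edges (y i) (g (y i)))" "a \<in> set (walk_edges (y i') (g (y i')))"
        obtain l l' where l: "l \<in> {i..<e i}" "l' \<in> {i'..<e i'}" "{y l, y (Suc l)} = {y l', y (Suc l')}"
          using * by (auto simp: g we)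
        have "e i \<le> M" "e i' \<le> M" using * I' I(2) by auto
        then have "l = l'" using l einj by (auto simp: inj_on_def)
        moreover have "i < i' \<or> i' < i" using * by (cases i i' rule: linorder_cases) auto
        ultimately show "a \<in> {}" using l I(3) * I' by (metis atLeastLessThan_iff le_trans not_le subsetD)
      qed
    qed
    show "\<forall>a\<in>y ` I'. follows c W a (g a)"
    proof safe
      fix i assume i: "i \<in> I'"
      then have "i \<le> e i" using I(2) I' by (meson less_imp_le subsetD)
      then show "follows c W (y i) (g (y i))" unfolding g[OF i] ps_def j_def by (rule follows_map)
    qed
  qed (rule W(1))
qed

section \<open>Attainment and measurability of \<open>Lmax\<close>\<close>

lemma finite_paths: "finite {xs. is_path n xs}"
  by (rule finite_subset[OF _ finite_subset_distinct[of "{..<n}"]]) (auto simp: is_path_def)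

lemma finite_light_lengths: "finite {path_len xs | xs. is_path n xs \<and> avg_weight W xs \<le> lam}"
  using finite_imageI[OF finite_paths[of n], of path_len] by (rule finite_subset[rotated]) auto

lemma Lmax_ge: "is_path n xs \<Longrightarrow> avg_weight W xs \<le> lam \<Longrightarrow> path_len xs \<le> Lmax n lam W"
  unfolding Lmax_def using finite_light_lengths by (intro Max_ge) auto

lemma Lmax_pos_path:
  assumes "0 < Lmax n lam W"
  shows "\<exists>xs. is_path n xs \<and> avg_weight W xs \<le> lam \<and> path_len xs = Lmax n lam W"
proof -
  have "Lmax n lam W \<in> insert 0 {path_len xs | xs. is_path n xs \<and> avg_weight W xs \<le> lam}"
    unfolding Lmax_def using finite_light_lengths by (intro Max_in) auto
  then show ?thesis using assms by auto
qed

lemma avg_weight_measurable [measurable]: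
  assumes "is_path n xs"
  shows "(\<lambda>W. avg_weight W xs) \<in> borel_measurable (weight_space n)"
proof -
  have [measurable]: "(\<lambda>W. W {xs ! i, xs ! Suc i}) \<in> borel_measurable (weight_space n)" if "i < path_len xs" for i
    using path_edge_in_edges[OF assms that] by (rule weight_component_measurable)
  show ?thesis unfolding avg_weight_def by measurable
qed

lemma Lmax_measurable [measurable]:
  "(\<lambda>W. Lmax n lam W) \<in> measurable (weight_space n) (count_space UNIV)"
proof -
  have le [measurable]: "Measurable.pred (weight_space n) (\<lambda>W. Lmax n lam W \<le> k)" for k
  proof -
    have "(\<lambda>W. Lmax n lam W \<le> k) = (\<lambda>W. \<forall>xs\<in>{xs. is_path n xs}. avg_weight W xs \<le> lam \<longrightarrow> path_len xs \<le> k)"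
      unfolding Lmax_def using finite_light_lengths by (subst Max_le_iff) auto
    then show ?thesis using finite_paths by simp
  qed
  have *: "{W \<in> space (weight_space n). Lmax n lam W = a} \<in> sets (weight_space n)" for a
  proof -
    have "(\<lambda>W. Lmax n lam W = a) = (\<lambda>W. Lmax n lam W \<le> a \<and> \<not> (\<exists>k\<in>{..<a}. Lmax n lam W \<le> k))"
      by (intro ext) (force simp: not_le)
    then have "Measurable.pred (weight_space n) (\<lambda>W. Lmax n lam W = a)" by simp
    then show ?thesis by (rule predE)
  qed
  show ?thesis
    unfolding measurable_count_space_eq2_countable
    using * by (auto simp: vimage_def Int_def conj_commute)
qed

text \<open>\<open>k ^ k / fact k\<close> is a single term of the series of
  \<open>exp k\<close>.\<close>

lemma power_le_fact_exp: "real k ^ k \<le> fact k * exp k"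
proof -
  have "real k ^ k / fact k \<le> exp (real k)"
    using sum_le_suminf[OF summable_exp_generic[of "real k"], of "{k}"] 
    by (simp add: exp_def divide_inverse mult.commute)
  then show ?thesis by (simp add: field_simps)
qed

text \<open>From \<open>n choose k \<le> (e n / k)^k\<close>; the hypothesis brings the base
  \<open>e n q / k\<close> down to 1/2.\<close>

lemma binomial_power_le:
  fixes q :: real
  assumes q: "0 \<le> q" and k: "2 * exp 1 * n * q \<le> real k" "0 < k"
  shows "(n choose k) * q ^ k \<le> (1 / 2) ^ k"
proof -
  have "real (n choose k) * fact k \<le> real n ^ k"
    using binomial_fact_pow[of n k] by (metis of_nat_fact of_nat_le_iff of_nat_mult of_nat_power)
  then have "(n choose k) \<le> real n ^ k / fact k" by (simp add: field_simps)
  also have "\<dots> \<le> real n ^ k * (exp k / real k ^ k)"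
    using mult_left_mono[OF power_le_fact_exp[of k], of "real n ^ k"] k by (simp add: field_simps)
  also have "\<dots> = (exp 1 * n / k) ^ k"
    by (simp add: power_divide power_mult_distrib exp_of_nat_mult[symmetric])
  finally have "(n choose k) * q ^ k \<le> (exp 1 * n / k) ^ k * q ^ k"
    using q by (intro mult_right_mono) auto
  also have "\<dots> = (exp 1 * n * q / k) ^ k" by (simp add: power_mult_distrib[symmetric])
  also have "\<dots> \<le> (1 / 2) ^ k" using q k by (intro power_mono) (auto simp: field_simps)
  finally show ?thesis .
qed

text \<open>The phase \<open>pi / 2\<close> gives a cosine centred in the band. The condition
  \<open>u * (m + 1) \<le> 1\<close> keeps all angles, overshoot included, within 1, where the
  cosine is at least 1/2. The factor 2 and the normalization \<open>r ^ (m * L)\<close> make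
  \<open>H\<close> at least 1 at the exit, so that its value at 0 is the bound.\<close>

lemma descents_rate_le:
  fixes u :: real and m L n T :: nat
  assumes L: "2 \<le> L" and u: "0 < u" "u * (m + 1) \<le> 1" and m: "1 \<le> m" and n: "0 < n"
  shows "(\<Sum>ps\<in>descents n L (int (m * L)) T 0. (rate L u / n) ^ length ps) \<le> 2 * exp (- (m / 3))"
proof -
  have "u * 1 \<le> u * (m + 1)" using u m by (intro mult_left_mono) auto
  then have u1: "u \<le> 1" using u(2) by (metis mult.right_neutral order_trans)
  note w = L u(1) u1
  define r where "r = ratio L u"
  define K where "K = int (m * L)"
  define H where "H x = 2 * r ^ (m * L) * wave L u (pi / 2) x" for x
  have r: "0 < r" "r \<le> 1" unfolding r_def using ratio_pos[OF w] ratio_le_one[OF w] by auto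
  have H: "H x = 2 * r powi (K + x) * cos (u / L * x)" for x
  proof -
    have "r ^ (m * L) * r powi x = r powi (K + x)"
      unfolding power_int_add[OF disjI1[OF r(1)[THEN less_imp_neq, symmetric]]] K_def power_int_of_nat ..
    then show ?thesis by (simp add: H_def wave_def r_def[symmetric] sin_add)
  qed
  have cos_ge: "1 / 2 \<le> cos (u / L * x)" if "\<bar>x\<bar> \<le> K + int L" for x :: int
  proof -
    have "real_of_int \<bar>x\<bar> \<le> real_of_int (int (m * L) + int L)"
      using that unfolding K_def by (rule of_int_le_iff[THEN iffD2])
    then have "real_of_int \<bar>x\<bar> \<le> real m * L + L" by simp
    moreover have "\<bar>u / L * x\<bar> = u / L * real_of_int \<bar>x\<bar>" using u L by (simp add: abs_mult)
    ultimately have "\<bar>u / L * x\<bar> \<le> u / L * (real m * L + L)"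
      using u by (simp only:) (intro mult_left_mono, auto)
    also have "u / L * (real m * L + L) = u * (m + 1)" using L by (simp add: field_simps)
    finally have *: "\<bar>u / L * x\<bar> \<le> 1" using u by simp
    have "1 / 2 \<le> cos y" if "\<bar>y\<bar> \<le> 1" for y :: real
    proof -
      have "y\<^sup>2 \<le> 1" using that by (simp add: abs_square_le_1)
      then show ?thesis using cos_ge_quadratic[of "\<bar>y\<bar>"] by simp
    qed
    from this[OF *] show ?thesis .
  qed
  have K0: "0 < K" using m L by (simp add: K_def)
  have "(\<Sum>ps\<in>descents n L K T 0. (rate L u / n) ^ length ps) \<le> H 0"
  proof (rule sum_descents_le[OF n])
    show "0 \<le> rate L u" using rate_pos[OF w] by simp
    show "0 \<le> H x" if "- K - int L < x" "x < K" for x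
    proof -
      have "1 / 2 \<le> cos (u / L * x)" using that K0 by (intro cos_ge) auto
      then show ?thesis unfolding H using r by (intro mult_nonneg_nonneg) auto
    qed
    show "1 \<le> H x" if "- K - int L < x" "x \<le> - K" for x
    proof -
      have "r powi (K + x) = inverse r ^ nat (- (K + x))"
        using that by (cases "K + x = 0") (auto simp: power_int_def)
      moreover have "1 \<le> inverse r ^ nat (- (K + x))"
        using r by (intro one_le_power) (simp add: one_le_inverse)
      moreover have "1 / 2 \<le> cos (u / L * x)" using that K0 by (intro cos_ge) auto
      ultimately have "2 * 1 * (1 / 2) \<le> 2 * r powi (K + x) * cos (u / L * x)"
        using r by (intro mult_mono) auto
      then show ?thesis unfolding H by simp
    qed
    show "rate L u * sum H {x + 1 - int L..K - 1} \<le> H x" if "- K < x" "x < K" for x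
    proof -
      \<comment> \<open>Stopping at \<open>K + int L - 1\<close> ends the sum at
        \<open>K - 1\<close>, the top of the band; the positive boundary term makes \<open>H\<close>
        a supersolution.\<close>
      have "H x = H (K + int L - 1) + rate L u * sum H {x + 1 - int L..K - 1}"
        using wave_telescope'[OF w, of x "K + int L - 1" "pi / 2"] that L
        by (simp add: H_def sum_distrib_left[symmetric] algebra_simps)
      moreover have "0 \<le> H (K + int L - 1)"
      proof -
        have "1 / 2 \<le> cos (u / L * (K + int L - 1))" using K0 L by (intro cos_ge) auto
        then show ?thesis unfolding H using r by (intro mult_nonneg_nonneg) auto
      qed
      ultimately show ?thesis by simp
    qed
  qed (use K0 in auto)
  also have "H 0 = 2 * r ^ (m * L)" by (simp add: H_def wave_def)
  also have "\<dots> \<le> 2 * exp (- (m / 3))" using ratio_power_le[OF w, of m] by (simp add: r_def)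
  finally show ?thesis by (simp add: K_def)
qed

lemma Lmax_upper:
  fixes \<eta> \<delta> u lam :: real and m L :: nat
  assumes \<eta>: "0 < \<eta>" and m: "1 \<le> m" and L: "2 \<le> L" and u: "0 < u" "u * (m + 1) \<le> 1"
    and rate: "lam + \<eta> \<le> (real L - 1) * rate L u" and lam: "0 \<le> lam" and \<delta>: "0 < \<delta>"
    and small: "16 * exp 1 * exp (- (m / 3)) \<le> \<delta> * \<eta> / (m + 1)"
  shows "(\<lambda>n. measure (weight_space n) {W \<in> space (weight_space n). n * \<delta> < Lmax n lam W}) \<longlonglongrightarrow> 0"
proof (rule tendsto_sandwich[OF always_eventually _ tendsto_const])
  \<comment> \<open>The slope surplus \<eta> amounts to \<open>\<eta> / c \<ge> \<eta> L / 2\<close>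
    heights per edge because \<open>L c \<le> 2\<close>. Over \<open>\<delta> n\<close> edges, and
    with a loss of at most \<open>(m + 1) L\<close> per descent, there are about
    \<open>\<kappa> n\<close> descents.\<close>
  define \<kappa> where "\<kappa> = \<delta> * \<eta> / (2 * (m + 1))"
  define k where "k n = nat \<lfloor>\<kappa> * real n\<rfloor>" for n :: nat
  define q where "q = 2 * exp (- (m / 3))"
  have "u * 1 \<le> u * (m + 1)" using u m by (intro mult_left_mono) auto
  then have u1: "u \<le> 1" using u(2) by (metis mult.right_neutral order_trans)
  note w = L u(1) u1
  define c where "c = rate L u"
  have c: "0 < c" "L * c \<le> 2" unfolding c_def using rate_pos[OF w] rate_le_2[OF w] by auto
  have \<kappa>: "0 < \<kappa>" using \<delta> \<eta> by (simp add: \<kappa>_def)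
  have q\<kappa>: "4 * exp 1 * q \<le> \<kappa>"
  proof -
    have "4 * exp 1 * q = 16 * exp 1 * exp (- (m / 3)) / 2" by (simp add: q_def)
    also have "\<dots> \<le> \<delta> * \<eta> / (m + 1) / 2" using small by (rule divide_right_mono) simp
    also have "\<dots> = \<kappa>" by (simp add: \<kappa>_def)
    finally show ?thesis .
  qed
  have q0: "0 \<le> q" by (simp add: q_def)
  have k_lim: "filterlim k at_top sequentially"
    unfolding k_def using \<kappa> by real_asymp
  show "(\<lambda>n. (1 / 2 :: real) ^ k n) \<longlonglongrightarrow> 0"
    by (rule filterlim_compose[OF _ k_lim]) (rule LIMSEQ_power_zero, simp)
  have "eventually (\<lambda>n. 1 \<le> k n) sequentially"
    using k_lim by (simp add: filterlim_at_top)
  then show "eventually (\<lambda>n. measure (weight_space n) {W \<in> space (weight_space n). n * \<delta> < Lmax n lam W} \<le> (1 / 2) ^ k n) sequentially"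
    using eventually_gt_at_top[of 0] eventually_ge_at_top[of "nat \<lceil>2 / \<kappa>\<rceil>"]
  proof eventually_elim
    case (elim n)
    interpret W: prob_space "weight_space n" using elim by (intro prob_space_weight_space) auto
    define B where "B = many_descents n c L (m * L) (k n)"
    have K: "0 < int (m * L)" using m L by simp
    have q: "(\<Sum>ps\<in>descents n L (m * L) n 0. (c / n) ^ length ps) \<le> q"
      unfolding q_def c_def using elim by (intro descents_rate_le L u m) auto
    have n: "0 < n" using elim by simp
    have kn: "k n \<le> \<kappa> * n" unfolding k_def using \<kappa> by (intro of_nat_floor) auto
    have "AE W in weight_space n. (n * \<delta> < Lmax n lam W) \<longrightarrow> W \<in> B"
      using AE_weight_nonneg[OF n] AE_space
    proof eventually_elim
      case (elim W)
      show ?case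
      proof
        assume W: "n * \<delta> < Lmax n lam W"
        moreover have "0 < n * \<delta>" using \<delta> n by simp
        ultimately have "0 < real (Lmax n lam W)" by linarith
        then obtain xs where xs: "is_path n xs" "avg_weight W xs \<le> lam" "path_len xs = Lmax n lam W"
          using Lmax_pos_path[of n lam W] by auto
        show "W \<in> B" unfolding B_def
        proof (rule light_path_many_descents[OF c(1) _ K elim(2,1) xs(1,2)])
          have "(real_of_int (int (m * L)) + L) * k n = ((real m + 1) * L) * k n" by (simp add: algebra_simps)
          also have "\<dots> \<le> ((real m + 1) * L) * (\<kappa> * n)" using kn by (intro mult_left_mono) auto
          also have "\<dots> = n * \<delta> * (\<eta> * L / 2)" by (simp add: \<kappa>_def field_simps)
          also have "\<dots> \<le> path_len xs * (\<eta> * L / 2)"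
            using W xs(3) \<eta> by (intro mult_right_mono) auto
          also have "\<dots> \<le> path_len xs * ((real L - 1) - lam / c)"
          proof (rule mult_left_mono)
            have "\<eta> * L / 2 \<le> \<eta> / c" using c \<eta> by (simp add: field_simps)
            also have "\<dots> \<le> (real L - 1) - lam / c" using rate c by (simp add: c_def field_simps)
            finally show "\<eta> * L / 2 \<le> (real L - 1) - lam / c" .
          qed simp
          finally show "(real_of_int (int (m * L)) + L) * k n \<le> path_len xs * ((real L - 1) - lam / c)" .
        qed (use L in auto)
      qed
    qed
    then have "W.prob {W \<in> space (weight_space n). n * \<delta> < Lmax n lam W} \<le> W.prob B"
      unfolding B_def using many_descents_le(1)[OF n c(1) K q] 
      by (intro W.finite_measure_mono_AE) (auto elim: eventually_mono)
    also have "\<dots> \<le> (n choose k n) * q ^ k n"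
      unfolding B_def by (rule many_descents_le(2)[OF n c(1) K q])
    also have "\<dots> \<le> (1 / 2) ^ k n"
    proof (rule binomial_power_le[OF q0])
      \<comment> \<open>Then rounding down loses at most half of \<open>\<kappa> n\<close>, which is
        why \<open>q\<kappa>\<close> has 4 where the binomial estimate asks for 2.\<close>
      have "2 \<le> \<kappa> * n" using elim(3) \<kappa> by (simp add: field_simps) 
      then have "\<kappa> * n / 2 \<le> k n" unfolding k_def by linarith
      moreover have "2 * exp 1 * n * q \<le> \<kappa> * n / 2" using mult_right_mono[OF q\<kappa>, of "real n"] by (simp add: mult_ac)
      ultimately show "2 * exp 1 * n * q \<le> k n" by linarith
    qed (use elim in auto)
    finally show ?case .
  qed
qed simp

text \<open>With \<open>m\<close> about \<open>1 / (6 sqrt \<eta>)\<close> and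
  \<open>u = 1 / (m + 1)\<close> one has \<open>u^2 \<ge> 36 \<eta>\<close>, and the excess
  \<open>exp (-1) * u^2 / 5\<close> covers \<open>2 \<eta>\<close> since e is below 18/5. The chosen
  \<delta> is about \<open>exp (- (m / 6))\<close>, so the descent probability
  \<open>exp (- (m / 3))\<close> beats it even after division by a power of
  \<open>m\<close>.\<close>

lemma Lmax_upper_tail:
  "\<exists>\<eta>s>0. \<forall>\<eta>. 0 < \<eta> \<and> \<eta> \<le> \<eta>s \<longrightarrow>
    (\<lambda>n. measure (weight_space n) {W \<in> space (weight_space n).
       n * exp (- (1 / 36) / sqrt \<eta>) < Lmax n (exp (-1) + \<eta>) W}) \<longlonglongrightarrow> 0"
proof -
  have "eventually (\<lambda>m::nat. 16 * exp 1 * exp (- (m / 3)) \<le> exp (- ((real m + 2) / 6)) * (1 / (36 * (real m + 2)\<^sup>2)) / (real m + 1)) sequentially"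
    by real_asymp
  then obtain m0 where m0: "\<And>m. m0 \<le> m \<Longrightarrow> 16 * exp 1 * exp (- (m / 3)) \<le> exp (- ((real m + 2) / 6)) * (1 / (36 * (real m + 2)\<^sup>2)) / (real m + 1)"
    by (auto simp: eventually_sequentially)
  show ?thesis
  proof (intro exI[of _ "1 / (36 * (real m0 + 3)\<^sup>2)"] conjI allI impI)
    fix \<eta> :: real assume \<eta>: "0 < \<eta> \<and> \<eta> \<le> 1 / (36 * (real m0 + 3)\<^sup>2)"
    define x where "x = 1 / (6 * sqrt \<eta>)"
    have sx: "sqrt \<eta> = 1 / (6 * x)" using \<eta> by (simp add: x_def)
    have "x\<^sup>2 = 1 / (36 * \<eta>)" using \<eta> by (simp add: x_def power_divide power_mult_distrib)
    then have \<eta>x: "\<eta> = 1 / (36 * x\<^sup>2)" using \<eta> by simp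
    have x0: "0 < x" using \<eta> by (simp add: x_def)
    have "(real m0 + 3)\<^sup>2 \<le> x\<^sup>2" using \<eta> x0 by (simp add: \<eta>x field_simps)
    then have x: "real m0 + 3 \<le> x" by (rule power2_le_imp_le) (use x0 in simp)
    define m where "m = nat \<lfloor>x\<rfloor> - 1"
    have m: "m0 \<le> m" "1 \<le> m" "m + 1 \<le> x" "x \<le> m + 2" using x unfolding m_def by linarith+
    define u where "u = 1 / (real m + 1)"
    have u: "0 < u" "u \<le> 1" "u * (m + 1) \<le> 1" by (auto simp: u_def)
    obtain L where L: "2 \<le> L" "exp (-1) * (1 + u\<^sup>2 / 5) \<le> (real L - 1) * rate L u"
      using rate_eventually_ge[OF u(1,2)] by auto
    have "36 * \<eta> \<le> u\<^sup>2"
      unfolding \<eta>x u_def using m x0 by (simp add: power_divide frac_le power_mono)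
    then have "exp (-1) * (36 * \<eta> / 5) \<le> exp (-1) * (u\<^sup>2 / 5)" by simp
    moreover have "2 * \<eta> \<le> exp (-1) * (36 * \<eta> / 5)"
      using \<eta> exp_le by (simp add: exp_minus field_simps)
    moreover have "exp (-1) * (1 + u\<^sup>2 / 5) = exp (-1) + exp (-1) * (u\<^sup>2 / 5)" by (simp add: distrib_left)
    ultimately have rate: "exp (-1) + \<eta> + \<eta> \<le> (real L - 1) * rate L u" using L(2) by linarith
    show "(\<lambda>n. measure (weight_space n) {W \<in> space (weight_space n).
       n * exp (- (1 / 36) / sqrt \<eta>) < Lmax n (exp (-1) + \<eta>) W}) \<longlonglongrightarrow> 0"
    proof (rule Lmax_upper[OF _ m(2) L(1) u(1,3) rate])
      have "exp (- ((real m + 2) / 6)) * (1 / (36 * (real m + 2)\<^sup>2)) \<le> exp (- (1 / 36) / sqrt \<eta>) * \<eta>"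
      proof (rule mult_mono)
        show "exp (- ((real m + 2) / 6)) \<le> exp (- (1 / 36) / sqrt \<eta>)" using m(4) by (simp add: sx)
        show "1 / (36 * (real m + 2)\<^sup>2) \<le> \<eta>" using m(4) x0 by (simp add: \<eta>x frac_le power_mono)
      qed auto
      then have "exp (- ((real m + 2) / 6)) * (1 / (36 * (real m + 2)\<^sup>2)) / (real m + 1) \<le> exp (- (1 / 36) / sqrt \<eta>) * \<eta> / (real m + 1)"
        by (rule divide_right_mono) auto
      then show "16 * exp 1 * exp (- (m / 3)) \<le> exp (- (1 / 36) / sqrt \<eta>) * \<eta> / (m + 1)"
        using m0[OF m(1)] by (simp add: add.commute)
    qed (use \<eta> in auto)
  qed simp
qed

section \<open>Depth-first search in a band of heights\<close>

text \<open>Admissible heights are \<open>1, \<dots>, N - 1\<close>; the value 0 means that the edge is rejected.\<close>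

definition outcome :: "nat \<Rightarrow> nat \<Rightarrow> real \<Rightarrow> int \<Rightarrow> real \<Rightarrow> int" where
  "outcome L N eps x w =
    (let y = x + \<lceil>w / eps\<rceil> - int L in if 0 < w \<and> 1 \<le> y \<and> y < int N then y else 0)"

lemma outcome_measurable [measurable]: "outcome L N eps x \<in> measurable borel (count_space UNIV)"
proof -
  define G where "G c = (let y = x + c - int L in if 1 \<le> y \<and> y < int N then y else 0)" for c
  have [measurable]: "(\<lambda>w. \<lceil>w / eps\<rceil>) \<in> measurable borel (count_space UNIV)"
    unfolding ceiling_def by measurable
  have [measurable]: "G \<in> measurable (count_space UNIV) (count_space UNIV)" by simp
  have "outcome L N eps x = (\<lambda>w. if 0 < w then G \<lceil>w / eps\<rceil> else 0)"
    by (auto simp: outcome_def G_def Let_def)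
  then show ?thesis by simp
qed

lemma outcome_range: "2 \<le> N \<Longrightarrow> outcome L N eps x w \<in> {0..<int N}"
  by (auto simp: outcome_def Let_def)

text \<open>Rounding up makes heights overestimate weights; summed along a stack, the bound
  telescopes to \<open>eps * L\<close> per edge plus \<open>eps\<close> times the net rise.\<close>

lemma outcome_weight_le:
  assumes "0 < eps" "outcome L N eps x w = y" "y \<noteq> 0"
  shows "w \<le> eps * (real_of_int y - real_of_int x + real L)"
proof -
  have "y = x + \<lceil>w / eps\<rceil> - int L" using assms by (auto simp: outcome_def Let_def split: if_splits)
  then have "w / eps \<le> y - x + L" by linarith
  then show ?thesis using assms(1) by (simp add: field_simps)
qed

text \<open>Fubini with the coordinate \<open>e\<close> split off. \<open>F (W(e := 0))\<close>
  represents \<open>F\<close> on the remaining coordinates, and applying the computation to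
  \<open>UNIV\<close> identifies its integral with that of \<open>F\<close>.\<close>

lemma nn_integral_independent_coordinate:
  fixes F :: "(nat set \<Rightarrow> real) \<Rightarrow> ennreal"
  assumes n: "0 < n" and e: "e \<in> edges n" and A: "A \<in> sets borel"
    and [measurable]: "F \<in> borel_measurable (weight_space n)"
    and F: "\<And>W w. F (W(e := w)) = F W"
  shows "(\<integral>\<^sup>+W. indicator A (W e) * F W \<partial>weight_space n) = emeasure (weight_law n) A * (\<integral>\<^sup>+W. F W \<partial>weight_space n)"
proof -
  interpret product_prob_space "\<lambda>_. weight_law n" "edges n" by (rule product_prob_space_weight) fact
  define I where "I = edges n - {e}"
  have I: "edges n = insert e I" "e \<notin> I" "finite I" using e by (auto simp: I_def)
  have P: "weight_space n = PiM (insert e I) (\<lambda>_. weight_law n)" by (simp add: weight_space_eq I(1))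
  have F': "(\<lambda>W. F (W(e := 0))) \<in> borel_measurable (PiM I (\<lambda>_. weight_law n))"
  proof (rule measurable_compose[where g = F])
    show "F \<in> borel_measurable (PiM (insert e I) (\<lambda>_. weight_law n))" using assms(4) by (simp add: P)
    show "(\<lambda>W. W(e := 0)) \<in> PiM I (\<lambda>_. weight_law n) \<rightarrow>\<^sub>M PiM (insert e I) (\<lambda>_. weight_law n)"
      by (rule measurable_fun_upd[where J = I]) auto
  qed
  have key: "(\<integral>\<^sup>+W. indicator B (W e) * F W \<partial>weight_space n) = emeasure (weight_law n) B * (\<integral>\<^sup>+W. F (W(e := 0)) \<partial>PiM I (\<lambda>_. weight_law n))"
    if [measurable]: "B \<in> sets borel" for B
  proof -
    have m: "(\<lambda>W. indicator B (W e) * F W) \<in> borel_measurable (weight_space n)"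
      using e by measurable
    have "(\<integral>\<^sup>+W. indicator B (W e) * F W \<partial>weight_space n) =
      (\<integral>\<^sup>+W. (\<integral>\<^sup>+w. indicator B ((W(e := w)) e) * F (W(e := w)) \<partial>weight_law n) \<partial>PiM I (\<lambda>_. weight_law n))"
      using m unfolding P by (rule product_nn_integral_insert[OF I(3,2)])
    also have "\<dots> = (\<integral>\<^sup>+W. (\<integral>\<^sup>+w. F (W(e := 0)) * indicator B w \<partial>weight_law n) \<partial>PiM I (\<lambda>_. weight_law n))"
      by (simp add: F mult.commute)
    also have "\<dots> = (\<integral>\<^sup>+W. F (W(e := 0)) * emeasure (weight_law n) B \<partial>PiM I (\<lambda>_. weight_law n))"
      by (simp add: nn_integral_cmult_indicator)
    also have "\<dots> = emeasure (weight_law n) B * (\<integral>\<^sup>+W. F (W(e := 0)) \<partial>PiM I (\<lambda>_. weight_law n))"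
      using F' by (subst mult.commute) (rule nn_integral_cmult)
    finally show ?thesis .
  qed
  have "emeasure (weight_law n) UNIV = 1"
    using prob_space.emeasure_space_1[OF prob_space_weight_law[OF n]] by simp
  then show ?thesis using key[OF A] key[of UNIV] by simp
qed

section \<open>The search, its moves and the accounting of gains\<close>

text \<open>The stack holds the current path with its tip first, each vertex with its height. The field
  \<open>gain\<close> is a ghost variable: the weights \<open>h\<close> of all vertices discovered through an edge, minus the
  charges \<open>q\<close> of all queries.\<close>

record search =
  stack :: "(nat \<times> int) list"
  unvisited :: "nat set"
  queried :: "nat set set"
  dead :: "(nat \<times> int) list"
  gain :: real

text \<open>\<open>k\<close> is the stack length aimed at and \<open>f\<close> the number of
  finished vertices at which the search gives up; \<open>f + k \<le> n\<close> keeps unvisited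
  vertices available until then. The assumption \<open>query\<close> says that one query at height
  \<open>x\<close> does not increase the expectation of
  \<open>exp (- \<theta> * gain)\<close>.\<close>

locale depth_first_search =
  fixes n k f N L :: nat and eps \<theta> :: real and h q :: "int \<Rightarrow> real"
  assumes n: "0 < n" and N: "2 \<le> N" and eps: "0 < eps" and \<theta>: "0 < \<theta>" and fk: "f + k \<le> n"
    and h_nonneg: "\<And>x. 1 \<le> x \<Longrightarrow> x < int N \<Longrightarrow> 0 \<le> h x"
    and q_nonneg: "\<And>x. 1 \<le> x \<Longrightarrow> x < int N \<Longrightarrow> 0 \<le> q x"
    and query: "\<And>x. 1 \<le> x \<Longrightarrow> x < int N \<Longrightarrow>
      (\<Sum>y\<in>{0..<int N}. measure (weight_law n) {w. outcome L N eps x w = y} *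
         exp (\<theta> * (q x - (if y = 0 then 0 else h y)))) \<le> 1"
begin

definition candidates :: "nat \<Rightarrow> search \<Rightarrow> nat set" where
  "candidates v s = {u \<in> unvisited s. {v, u} \<notin> queried s}"

definition answer :: "nat \<Rightarrow> int \<Rightarrow> nat \<Rightarrow> int \<Rightarrow> search \<Rightarrow> search" where
  "answer v x u y s = s\<lparr>stack := (if y = 0 then stack s else (u, y) # stack s),
     unvisited := (if y = 0 then unvisited s else unvisited s - {u}),
     queried := insert {v, u} (queried s),
     gain := gain s - q x + (if y = 0 then 0 else h y)\<rparr>"

definition halted :: "search \<Rightarrow> bool" where
  "halted s \<longleftrightarrow> k \<le> length (stack s) \<or> f \<le> length (dead s)"

text \<open>A root enters at height 1 without a query and earns nothing, so the gain never exceeds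
  what the potentials account for.\<close>

definition restart :: "search \<Rightarrow> search" where
  "restart s = s\<lparr>stack := [(Min (unvisited s), 1)], unvisited := unvisited s - {Min (unvisited s)}\<rparr>"

definition retreat :: "search \<Rightarrow> search" where
  "retreat s = s\<lparr>stack := tl (stack s), dead := hd (stack s) # dead s\<rparr>"

text \<open>The first argument is fuel. All choices are deterministic, and \<open>W\<close> is
  consulted only at the edge being queried, which is fresh because \<open>candidates\<close>
  excludes queried edges.\<close>

primrec run :: "nat \<Rightarrow> search \<Rightarrow> (nat set \<Rightarrow> real) \<Rightarrow> search" where
  "run 0 s W = s"
| "run (Suc t) s W = (if halted s then s else
    (case stack s of
      [] \<Rightarrow> run t (restart s) W
    | (v, x) # st \<Rightarrow>
        (if candidates v s = {} then run t (retreat s) W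
         else run t (answer v x (Min (candidates v s)) (outcome L N eps x (W {v, Min (candidates v s)})) s) W)))"

definition potential :: "(nat \<times> int) list \<Rightarrow> real" where
  "potential xs = (\<Sum>(v, x)\<leftarrow>xs. h x)"

text \<open>A finished vertex has queried all vertices that are still unvisited, so its charges amount to at
  least \<open>q x\<close> times their number.\<close>

definition debt :: "search \<Rightarrow> real" where
  "debt s = (\<Sum>(v, x)\<leftarrow>dead s. q x * card (unvisited s)) +
     (\<Sum>(v, x)\<leftarrow>stack s. q x * card {u \<in> unvisited s. {v, u} \<in> queried s})"

text \<open>The last clause combines two facts: the discovered vertices earned at most their
  potential, and the charges paid amount to at least \<open>debt\<close>. That no edge inside the
  unvisited set has been queried lets every newly found vertex start without debt.\<close>

definition valid :: "search \<Rightarrow> bool" where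
  "valid s \<longleftrightarrow> unvisited s \<subseteq> {..<n} \<and> fst ` set (stack s) \<subseteq> {..<n} - unvisited s \<and> distinct (map fst (stack s)) \<and>
     card (unvisited s) + length (stack s) + length (dead s) = n \<and> length (dead s) \<le> f \<and>
     snd ` set (stack s) \<subseteq> {1..<int N} \<and> snd ` set (dead s) \<subseteq> {1..<int N} \<and>
     (\<forall>a\<in>unvisited s. \<forall>b\<in>unvisited s. {a, b} \<notin> queried s) \<and> queried s \<subseteq> edges n \<and>
     gain s + debt s \<le> potential (stack s) + potential (dead s)"

definition linked :: "(nat set \<Rightarrow> real) \<Rightarrow> search \<Rightarrow> bool" where
  "linked W s \<longleftrightarrow> successively (\<lambda>(u, y) (v, x). W {u, v} \<le> eps * (real_of_int y - real_of_int x + real L)) (stack s)"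

lemma finite_unvisited: "valid s \<Longrightarrow> finite (unvisited s)"
  by (auto simp: valid_def intro: finite_subset)

lemma sum_list_debt_mono:
  assumes "snd ` set xs \<subseteq> {1..<int N}" "\<And>v x. (v, x) \<in> set xs \<Longrightarrow> a v \<le> b v"
  shows "(\<Sum>(v, x)\<leftarrow>xs. q x * real (a v)) \<le> (\<Sum>(v, x)\<leftarrow>xs. q x * real (b v))"
  using assms by (intro sum_list_mono) (force intro!: mult_left_mono q_nonneg)

lemma unvisited_nonempty:
  assumes "valid s" "\<not> halted s"
  shows "unvisited s \<noteq> {}"
  using assms fk by (auto simp: valid_def halted_def)

lemma valid_restart:
  assumes v: "valid s" and s: "\<not> halted s" "stack s = []"
  shows "valid (restart s)"
proof -
  define u where "u = Min (unvisited s)"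
  have u: "u \<in> unvisited s" unfolding u_def using unvisited_nonempty[OF v s(1)] finite_unvisited[OF v] by simp
  have fin: "finite (unvisited s)" by (rule finite_unvisited[OF v])
  have d: "(\<Sum>(v, x)\<leftarrow>dead s. q x * card (unvisited s - {u})) \<le> (\<Sum>(v, x)\<leftarrow>dead s. q x * card (unvisited s))"
    using v fin by (intro sum_list_debt_mono) (auto simp: valid_def intro!: card_mono)
  have e: "{w \<in> unvisited s - {u}. {u, w} \<in> queried s} = {}"
    using v u by (auto simp: valid_def)
  have "debt (restart s) = (\<Sum>(v, x)\<leftarrow>dead s. q x * card (unvisited s - {u})) + q 1 * card {w \<in> unvisited s - {u}. {u, w} \<in> queried s}"
    by (simp add: debt_def restart_def u_def)
  then have "debt (restart s) = (\<Sum>(v, x)\<leftarrow>dead s. q x * card (unvisited s - {u}))"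
    unfolding e by simp
  moreover note d
  moreover have "debt s = (\<Sum>(v, x)\<leftarrow>dead s. q x * card (unvisited s))"
    using s by (simp add: debt_def)
  moreover have "0 \<le> h 1" using N by (intro h_nonneg) auto
  moreover have "potential (stack (restart s)) = h 1" "potential (stack s) = 0"
    using s by (simp_all add: potential_def restart_def)
  moreover have "gain s + debt s \<le> potential (stack s) + potential (dead s)" using v by (simp add: valid_def)
  ultimately have g: "gain s + debt (restart s) \<le> potential (stack (restart s)) + potential (dead s)"
    by linarith
  have c: "card (unvisited s) = Suc (card (unvisited s - {u}))"
    using fin u by (rule card.remove)
  have r: "stack (restart s) = [(u, 1)]" "unvisited (restart s) = unvisited s - {u}"
    "queried (restart s) = queried s" "dead (restart s) = dead s" "gain (restart s) = gain s"
    by (simp_all add: restart_def u_def)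
  have "u < n" using v u by (auto simp: valid_def)
  then show ?thesis using v s N c g unfolding valid_def r by auto
qed

lemma valid_retreat:
  assumes v: "valid s" and s: "\<not> halted s" "stack s = (a, x) # st" "candidates a s = {}"
  shows "valid (retreat s)"
proof -
  have "{u \<in> unvisited s. {a, u} \<in> queried s} = unvisited s"
    using s(3) by (auto simp: candidates_def)
  then have "debt (retreat s) = debt s"
    using s(2) by (simp add: debt_def retreat_def)
  moreover have "potential (stack (retreat s)) + potential (dead (retreat s)) = potential (stack s) + potential (dead s)"
    using s(2) by (simp add: potential_def retreat_def)
  ultimately show ?thesis using v s unfolding valid_def retreat_def halted_def by auto
qed

text \<open>The query adds at most one vertex to the count charged to the tip, so the debt rises by
  at most \<open>q x\<close>, which is what the gain pays. If \<open>u\<close> is discovered, gain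
  and potential both rise by \<open>h y\<close>, and removing \<open>u\<close> from the unvisited
  set can only lower the other terms.\<close>

lemma valid_answer:
  assumes v: "valid s" and s: "stack s = (a, x) # st" and u: "u \<in> candidates a s"
    and y: "y \<in> {0..<int N}"
  shows "valid (answer a x u y s)"
proof -
  have fin: "finite (unvisited s)" by (rule finite_unvisited[OF v])
  define T where "T = (if y = 0 then unvisited s else unvisited s - {u})"
  have T: "T \<subseteq> unvisited s" by (auto simp: T_def)
  have finT: "finite T" using T fin by (rule finite_subset)
  have uT: "u \<in> unvisited s" "{a, u} \<notin> queried s" using u by (auto simp: candidates_def)
  have a: "a \<notin> unvisited s" "a < n" "u < n" using v s uT by (auto simp: valid_def)
  have x: "1 \<le> x" "x < int N" using v s by (auto simp: valid_def)
  have st: "b \<noteq> a \<and> b \<notin> unvisited s" if "(b, z) \<in> set st" for b z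
  proof -
    have "b \<in> fst ` set st" using that by force
    moreover have "a \<notin> fst ` set st" "fst ` set st \<subseteq> {..<n} - unvisited s" using v s by (auto simp: valid_def)
    ultimately show ?thesis by blast
  qed
  have st_types: "snd ` set st \<subseteq> {1..<int N}"
    using v s by (auto simp: valid_def)
  have 1: "(\<Sum>(v, x)\<leftarrow>dead s. q x * card T) \<le> (\<Sum>(v, x)\<leftarrow>dead s. q x * card (unvisited s))"
    using v T fin by (intro sum_list_debt_mono) (auto simp: valid_def intro!: card_mono)
  have 2: "(\<Sum>(v, x)\<leftarrow>st. q x * card {w \<in> T. {v, w} \<in> insert {a, u} (queried s)})
      \<le> (\<Sum>(v, x)\<leftarrow>st. q x * card {w \<in> unvisited s. {v, w} \<in> queried s})"
  proof (rule sum_list_debt_mono[OF st_types])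
    fix b z assume "(b, z) \<in> set st"
    then have "b \<noteq> a" "b \<noteq> u" using st uT by auto
    then show "card {w \<in> T. {b, w} \<in> insert {a, u} (queried s)} \<le> card {w \<in> unvisited s. {b, w} \<in> queried s}"
      using T fin by (intro card_mono) (auto simp: doubleton_eq_iff)
  qed
  have 3: "q x * card {w \<in> T. {a, w} \<in> insert {a, u} (queried s)} \<le> q x * card {w \<in> unvisited s. {a, w} \<in> queried s} + q x"
  proof -
    have "card {w \<in> T. {a, w} \<in> insert {a, u} (queried s)} \<le> card (insert u {w \<in> unvisited s. {a, w} \<in> queried s})"
      using T fin by (intro card_mono) (auto simp: doubleton_eq_iff)
    also have "\<dots> \<le> card {w \<in> unvisited s. {a, w} \<in> queried s} + 1"
      using fin by (simp add: card_insert_if)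
    finally have "real (card {w \<in> T. {a, w} \<in> insert {a, u} (queried s)}) \<le> card {w \<in> unvisited s. {a, w} \<in> queried s} + 1"
      by linarith
    then have "q x * card {w \<in> T. {a, w} \<in> insert {a, u} (queried s)} \<le> q x * (card {w \<in> unvisited s. {a, w} \<in> queried s} + 1)"
      using q_nonneg[OF x] by (rule mult_left_mono)
    then show ?thesis by (simp add: algebra_simps)
  qed
  have 4: "y \<noteq> 0 \<Longrightarrow> {w \<in> T. {u, w} \<in> insert {a, u} (queried s)} = {}"
    using v uT a T by (auto simp: valid_def T_def doubleton_eq_iff)
  have pot: "gain (answer a x u y s) + debt (answer a x u y s) \<le> potential (stack (answer a x u y s)) + potential (dead s)"
  proof (cases "y = 0")
    case True
    then have "T = unvisited s" by (simp add: T_def)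
    then show ?thesis using True v s 1 2 3
      by (simp add: valid_def debt_def potential_def answer_def)
  next
    case False
    then have "unvisited (answer a x u y s) = T" by (simp add: answer_def T_def)
    then have "debt (answer a x u y s) = (\<Sum>(v, x)\<leftarrow>dead s. q x * card T) + (q y * card {w \<in> T. {u, w} \<in> insert {a, u} (queried s)}
       + (q x * card {w \<in> T. {a, w} \<in> insert {a, u} (queried s)} + (\<Sum>(v, x)\<leftarrow>st. q x * card {w \<in> T. {v, w} \<in> insert {a, u} (queried s)})))"
      using False s unfolding debt_def by (simp add: answer_def)
    then have "debt (answer a x u y s) \<le> debt s + q x"
      unfolding 4[OF False] using 1 2 3 s by (simp add: debt_def)
    moreover have "gain (answer a x u y s) = gain s - q x + h y" "potential (stack (answer a x u y s)) = potential (stack s) + h y"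
      using False by (simp_all add: answer_def potential_def)
    ultimately show ?thesis using v by (simp add: valid_def)
  qed
  define s' where "s' = answer a x u y s"
  have s': "stack s' = (if y = 0 then stack s else (u, y) # stack s)" "unvisited s' = T"
    "queried s' = insert {a, u} (queried s)" "dead s' = dead s"
    by (simp_all add: s'_def answer_def T_def)
  have edge: "{a, u} \<in> edges n" using a uT by (auto simp: edges_def)
  have card: "card (unvisited s) = Suc (card (unvisited s - {u}))"
    using fin uT(1) by (rule card.remove)
  have uS: "u \<notin> fst ` set (stack s)" using v uT by (auto simp: valid_def)
  have fresh: "{b, c} \<noteq> {a, u}" if "b \<in> T" "c \<in> T" for b c
    using a that T by (auto simp: doubleton_eq_iff)
  have "valid s'"
    unfolding valid_def
  proof (intro conjI)
    show "unvisited s' \<subseteq> {..<n}" using v T unfolding s' valid_def by blast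
    show "fst ` set (stack s') \<subseteq> {..<n} - unvisited s'"
      using v a unfolding s' valid_def T_def by (cases "y = 0") auto
    show "distinct (map fst (stack s'))"
      using v uS unfolding s' valid_def by simp
    show "card (unvisited s') + length (stack s') + length (dead s') = n"
      using v card unfolding s' valid_def T_def by simp
    show "length (dead s') \<le> f" "snd ` set (dead s') \<subseteq> {1..<int N}" using v unfolding s' valid_def by blast+
    show "snd ` set (stack s') \<subseteq> {1..<int N}" using v y unfolding s' valid_def by (cases "y = 0") auto
    show "\<forall>b\<in>unvisited s'. \<forall>c\<in>unvisited s'. {b, c} \<notin> queried s'"
    proof (intro ballI)
      fix b c assume "b \<in> unvisited s'" "c \<in> unvisited s'"
      then have bc: "b \<in> T" "c \<in> T" by (simp_all only: s')
      then have "b \<in> unvisited s" "c \<in> unvisited s" using T by auto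
      then have "{b, c} \<notin> queried s" using v unfolding valid_def by meson
      then show "{b, c} \<notin> queried s'" using fresh[OF bc] unfolding s' by simp
    qed
    show "queried s' \<subseteq> edges n" using v edge unfolding s' valid_def by blast
    show "gain s' + debt s' \<le> potential (stack s') + potential (dead s')"
      using pot by (simp only: s'_def[symmetric] s'(4))
  qed
  then show ?thesis by (simp add: s'_def)
qed

section \<open>Termination, measurability and the supermartingale\<close>

definition remaining :: "search \<Rightarrow> nat" where
  "remaining s = card (edges n - queried s) + 2 * card (unvisited s) + length (stack s)"

lemma remaining_restart:
  assumes "valid s" "\<not> halted s" "stack s = []"
  shows "remaining (restart s) < remaining s"
proof -
  have "Min (unvisited s) \<in> unvisited s" using unvisited_nonempty finite_unvisited assms by simp
  then have "card (unvisited s) = Suc (card (unvisited s - {Min (unvisited s)}))"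
    using finite_unvisited[OF assms(1)] by (intro card.remove)
  then show ?thesis using assms by (simp add: remaining_def restart_def)
qed

lemma remaining_retreat: "stack s \<noteq> [] \<Longrightarrow> remaining (retreat s) < remaining s"
  by (simp add: remaining_def retreat_def)

lemma remaining_answer:
  assumes "valid s" "stack s = (a, x) # st" "u \<in> candidates a s"
  shows "remaining (answer a x u y s) < remaining s"
proof -
  have u: "u \<in> unvisited s" "{a, u} \<notin> queried s" using assms(3) by (auto simp: candidates_def)
  have "a < n" "u < n" "a \<noteq> u" using assms u by (auto simp: valid_def)
  then have "{a, u} \<in> edges n" by (auto simp: edges_def)
  then have "card (edges n - insert {a, u} (queried s)) < card (edges n - queried s)"
    using u by (intro psubset_card_mono) auto
  moreover have "card (unvisited s) = Suc (card (unvisited s - {u}))"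
    using finite_unvisited[OF assms(1)] u by (intro card.remove)
  ultimately show ?thesis by (simp add: remaining_def answer_def)
qed

lemma Min_candidates: "valid s \<Longrightarrow> candidates v s \<noteq> {} \<Longrightarrow> Min (candidates v s) \<in> candidates v s"
  using finite_unvisited[of s] by (intro Min_in) (auto simp: candidates_def)

lemma run_invariants:
  assumes "valid s" "linked W s" "remaining s \<le> t"
  shows "halted (run t s W) \<and> valid (run t s W) \<and> linked W (run t s W)"
  using assms
proof (induction t arbitrary: s)
  case 0
  \<comment> \<open>Exhausted fuel means no unvisited vertex, whereas a search that has not halted
    always has one.\<close>
  then have "unvisited s = {}" using finite_unvisited[of s] by (simp add: remaining_def)
  then show ?case using unvisited_nonempty[of s] 0 by auto
next
  case (Suc t)
  show ?case
  proof (cases "halted s")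
    case True
    then show ?thesis using Suc.prems by simp
  next
    case nh: False
    show ?thesis
    proof (cases "stack s")
      case Nil
      have "linked W (restart s)" by (simp add: linked_def restart_def)
      then show ?thesis
        using Suc.IH[OF valid_restart[OF Suc.prems(1) nh Nil]] remaining_restart[OF Suc.prems(1) nh Nil] Suc.prems nh Nil
        by simp
    next
      case (Cons p st)
      obtain a x where p: "p = (a, x)" by (cases p)
      note st = Cons[unfolded p]
      show ?thesis
      proof (cases "candidates a s = {}")
        case True
        have "linked W (retreat s)" using Suc.prems(2) st
          by (cases st) (auto simp: linked_def retreat_def)
        then show ?thesis
          using Suc.IH[OF valid_retreat[OF Suc.prems(1) nh st True]] remaining_retreat[of s] Suc.prems nh st True
          by simp
      next
        case False
        define u where "u = Min (candidates a s)"
        define y where "y = outcome L N eps x (W {a, u})"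
        have u: "u \<in> candidates a s" unfolding u_def using Min_candidates Suc.prems(1) False by simp
        have "linked W (answer a x u y s)"
          using Suc.prems(2) st outcome_weight_le[OF eps, of L N x "W {a, u}" y]
          by (auto simp: linked_def answer_def y_def insert_commute)
        moreover have "valid (answer a x u y s)"
          using outcome_range[OF N] by (intro valid_answer[OF Suc.prems(1) st u]) (simp add: y_def)
        ultimately show ?thesis
          using Suc.IH[of "answer a x u y s"] remaining_answer[OF Suc.prems(1) st u, of y] Suc.prems nh st False
          by (simp add: u_def y_def)
      qed
    qed
  qed
qed

text \<open>A queried edge is never consulted again. Hence the continuation after a query does not
  depend on the weight just revealed, except through its outcome.\<close>

lemma run_fun_upd: "finite (unvisited s) \<Longrightarrow> e \<in> queried s \<Longrightarrow> run t s (W(e := w)) = run t s W"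
proof (induction t arbitrary: s)
  case (Suc t)
  show ?case
  proof (cases "stack s")
    case Nil
    have "e \<in> queried (restart s)" "finite (unvisited (restart s))" using Suc.prems by (simp_all add: restart_def)
    then show ?thesis using Suc.IH Nil by simp
  next
    case (Cons p st)
    obtain a x where p: "p = (a, x)" by (cases p)
    show ?thesis
    proof (cases "candidates a s = {} \<or> halted s")
      case True
      have "e \<in> queried (retreat s)" "finite (unvisited (retreat s))" using Suc.prems by (simp_all add: retreat_def)
      then show ?thesis using Suc.IH Cons p True by auto
    next
      case False
      define u where "u = Min (candidates a s)"
      have "u \<in> candidates a s"
        unfolding u_def using Suc.prems False by (intro Min_in) (auto simp: candidates_def)
      then have "{a, u} \<noteq> e" using Suc.prems by (auto simp: candidates_def)
      moreover have "e \<in> queried (answer a x u y s)" "finite (unvisited (answer a x u y s))" for y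
        using Suc.prems by (simp_all add: answer_def)
      ultimately show ?thesis using Suc.IH Cons p False by (simp add: u_def)
    qed
  qed
qed simp

lemma run_measurable: "valid s \<Longrightarrow> (\<lambda>W. run t s W) \<in> measurable (weight_space n) (count_space UNIV)"
proof (induction t arbitrary: s)
  case (Suc t)
  show ?case
  proof (cases "halted s")
    case True
    then show ?thesis by simp
  next
    case nh: False
    show ?thesis
    proof (cases "stack s")
      case Nil
      then show ?thesis using Suc.IH[OF valid_restart[OF Suc.prems nh Nil]] nh by simp
    next
      case (Cons p st)
      obtain a x where p: "p = (a, x)" by (cases p)
      note st = Cons[unfolded p]
      show ?thesis
      proof (cases "candidates a s = {}")
        case True
        then show ?thesis using Suc.IH[OF valid_retreat[OF Suc.prems nh st True]] nh st by simp
      next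
        case False
        define u where "u = Min (candidates a s)"
        have u: "u \<in> candidates a s" unfolding u_def using Min_candidates Suc.prems False by simp
        have e: "{a, u} \<in> edges n"
          using valid_answer[OF Suc.prems st u, of 0] N by (simp add: valid_def answer_def)
        \<comment> \<open>States contain reals, but this step depends on \<open>W\<close> only
          through an outcome with finitely many values, so the counting sigma-algebra is still
          manageable.\<close>
        have "(\<lambda>W. run t (answer a x u (outcome L N eps x (W {a, u})) s) W) \<in> measurable (weight_space n) (count_space UNIV)"
        proof (rule measurable_compose_countable'[where I = "{0..<int N}" and f = "\<lambda>y W. run t (answer a x u y s) W"])
          have o: "(\<lambda>W. outcome L N eps x (W {a, u})) \<in> measurable (weight_space n) (count_space UNIV)"
            by (rule measurable_compose[OF weight_component_measurable[OF e] outcome_measurable])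
          show "(\<lambda>W. outcome L N eps x (W {a, u})) \<in> measurable (weight_space n) (count_space {0..<int N})"
            using outcome_range[OF N] by (intro measurable_count_space_extend[OF subset_UNIV _ o] Pi_I)
          show "(\<lambda>W. run t (answer a x u y s) W) \<in> measurable (weight_space n) (count_space UNIV)" if "y \<in> {0..<int N}" for y
            using that by (intro Suc.IH valid_answer[OF Suc.prems st u])
        qed auto
        then show ?thesis using nh st False by (simp add: u_def)
      qed
    qed
  qed
next
  case 0
  have "run 0 s = (\<lambda>_. s)" by (rule ext) simp
  then show ?case by simp
qed

text \<open>Each edge is queried at most once, so its weight is independent of the rest of the run and the
  assumption \<open>query\<close> makes the exponential of the gain a supermartingale.\<close>

lemma run_supermartingale:
  "valid s \<Longrightarrow> (\<integral>\<^sup>+W. ennreal (exp (- \<theta> * gain (run t s W))) \<partial>weight_space n) \<le> ennreal (exp (- \<theta> * gain s))"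
proof (induction t arbitrary: s)
  case 0
  interpret W: prob_space "weight_space n" by (rule prob_space_weight_space[OF n])
  show ?case by (simp add: W.emeasure_space_1)
next
  case (Suc t)
  interpret W: prob_space "weight_space n" by (rule prob_space_weight_space[OF n])
  interpret law: prob_space "weight_law n" by (rule prob_space_weight_law[OF n])
  show ?case
  proof (cases "halted s")
    case True
    then show ?thesis by (simp add: W.emeasure_space_1)
  next
    case nh: False
    show ?thesis
    proof (cases "stack s")
      case Nil
      then show ?thesis using Suc.IH[OF valid_restart[OF Suc.prems nh Nil]] nh by (simp add: restart_def)
    next
      case (Cons p st)
      obtain a x where p: "p = (a, x)" by (cases p)
      note st = Cons[unfolded p]
      show ?thesis
      proof (cases "candidates a s = {}")
        case True
        then show ?thesis using Suc.IH[OF valid_retreat[OF Suc.prems nh st True]] nh st by (simp add: retreat_def)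
      next
        case False
        define u where "u = Min (candidates a s)"
        have u: "u \<in> candidates a s" unfolding u_def using Min_candidates Suc.prems False by simp
        have va: "valid (answer a x u y s)" if "y \<in> {0..<int N}" for y
          using that by (rule valid_answer[OF Suc.prems st u])
        have e: "{a, u} \<in> edges n"
          using va[of 0] N by (simp add: valid_def answer_def)
        define F where "F y W = ennreal (exp (- \<theta> * gain (run t (answer a x u y s) W)))" for y W
        define A where "A y = {w. outcome L N eps x w = y}" for y
        have A [measurable]: "A y \<in> sets borel" for y unfolding A_def by measurable
        have F_meas [measurable]: "F y \<in> borel_measurable (weight_space n)" if "y \<in> {0..<int N}" for y
          unfolding F_def using run_measurable[OF va[OF that]]
          by (rule measurable_compose[where g = "\<lambda>s. ennreal (exp (- \<theta> * gain s))"]) simp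
        have F_upd: "F y (W({a, u} := w)) = F y W" for y W w
          unfolding F_def using finite_unvisited[OF Suc.prems] by (subst run_fun_upd) (auto simp: answer_def)
        have x: "1 \<le> x" "x < int N" using Suc.prems st by (auto simp: valid_def)
        have "(\<integral>\<^sup>+W. ennreal (exp (- \<theta> * gain (run (Suc t) s W))) \<partial>weight_space n)
          = (\<integral>\<^sup>+W. (\<Sum>y\<in>{0..<int N}. indicator (A y) (W {a, u}) * F y W) \<partial>weight_space n)"
        proof (rule nn_integral_cong)
          fix W
          define y where "y = outcome L N eps x (W {a, u})"
          have y: "y \<in> {0..<int N}" unfolding y_def by (rule outcome_range[OF N])
          have "(\<Sum>y\<in>{0..<int N}. indicator (A y) (W {a, u}) * F y W) = (\<Sum>z\<in>{0..<int N}. if z = y then F y W else 0)"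
            by (intro sum.cong) (auto simp: A_def y_def)
          also have "\<dots> = F y W" using y by simp
          finally show "ennreal (exp (- \<theta> * gain (run (Suc t) s W))) = (\<Sum>y\<in>{0..<int N}. indicator (A y) (W {a, u}) * F y W)"
            using nh st False by (simp add: F_def y_def u_def)
        qed
        also have "\<dots> = (\<Sum>y\<in>{0..<int N}. \<integral>\<^sup>+W. indicator (A y) (W {a, u}) * F y W \<partial>weight_space n)"
          using e by (intro nn_integral_sum) measurable
        also have "\<dots> = (\<Sum>y\<in>{0..<int N}. emeasure (weight_law n) (A y) * (\<integral>\<^sup>+W. F y W \<partial>weight_space n))"
          by (intro sum.cong refl nn_integral_independent_coordinate n e A F_meas F_upd)
        also have "\<dots> \<le> (\<Sum>y\<in>{0..<int N}. emeasure (weight_law n) (A y) * ennreal (exp (- \<theta> * gain (answer a x u y s))))"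
          unfolding F_def by (intro sum_mono mult_left_mono Suc.IH va) auto
        \<comment> \<open>The answer \<open>y\<close> changes the gain by the negative of the
          bracket in \<open>query\<close>.\<close>
        also have "\<dots> = (\<Sum>y\<in>{0..<int N}. ennreal (exp (- \<theta> * gain s) * (measure (weight_law n) (A y) * exp (\<theta> * (q x - (if y = 0 then 0 else h y))))))"
          by (intro sum.cong refl) (simp add: law.emeasure_eq_measure ennreal_mult'[symmetric] answer_def exp_add[symmetric] algebra_simps)
        also have "\<dots> = ennreal (exp (- \<theta> * gain s) * (\<Sum>y\<in>{0..<int N}. measure (weight_law n) (A y) * exp (\<theta> * (q x - (if y = 0 then 0 else h y)))))"
          by (subst sum_ennreal) (auto simp: sum_distrib_left)
        also have "\<dots> \<le> ennreal (exp (- \<theta> * gain s) * 1)"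
          using query[OF x] unfolding A_def by (intro ennreal_leI mult_left_mono) auto
        finally show ?thesis by simp
      qed
    qed
  qed
qed

section \<open>From the gain to a long light path\<close>

definition start :: search where
  "start = \<lparr>stack = [], unvisited = {..<n}, queried = {}, dead = [], gain = 0\<rparr>"

lemma valid_start: "valid start"
  by (simp add: valid_def start_def debt_def potential_def)

lemma linked_start: "linked W start"
  by (simp add: linked_def start_def)

text \<open>If the search stops with a short stack, the finished vertices have been charged more than the
  discovered ones have earned.\<close>

lemma gain_le:
  fixes \<beta> hmin :: real
  assumes v: "valid s" and s: "halted s" "length (stack s) < k"
    and q: "\<And>x. 1 \<le> x \<Longrightarrow> x < int N \<Longrightarrow> (1 + \<beta>) * h x \<le> q x * (n - k - f)"
    and h: "\<And>x. 1 \<le> x \<Longrightarrow> x < int N \<Longrightarrow> hmin \<le> h x \<and> h x \<le> 1" and \<beta>: "0 \<le> \<beta>"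
  shows "gain s \<le> k - \<beta> * hmin * f"
proof -
  have len: "length (dead s) = f" using s v by (auto simp: halted_def valid_def)
  have types: "snd ` set (stack s) \<subseteq> {1..<int N}" "snd ` set (dead s) \<subseteq> {1..<int N}"
    using v by (auto simp: valid_def)
  \<comment> \<open>With a short stack the search must have halted on \<open>f\<close> finished
    vertices; everything outside these and the stack is unvisited.\<close>
  have "n - k - f \<le> card (unvisited s)" using v s len by (auto simp: valid_def)
  have "(\<Sum>(v, x)\<leftarrow>dead s. h x + \<beta> * hmin) \<le> (\<Sum>(v, x)\<leftarrow>dead s. q x * card (unvisited s))"
  proof (rule sum_list_mono, clarify)
    fix a x assume "(a, x) \<in> set (dead s)"
    then have x: "1 \<le> x" "x < int N" using types by auto
    have "h x + \<beta> * hmin \<le> (1 + \<beta>) * h x" using h[OF x] \<beta> by (simp add: algebra_simps mult_left_mono)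
    also have "\<dots> \<le> q x * (n - k - f)" by (rule q[OF x])
    also have "\<dots> \<le> q x * card (unvisited s)"
      using q_nonneg[OF x] \<open>n - k - f \<le> card (unvisited s)\<close> by (intro mult_left_mono) auto
    finally show "h x + \<beta> * hmin \<le> q x * card (unvisited s)" .
  qed
  moreover have "(\<Sum>(v, x)\<leftarrow>dead s. h x + \<beta> * hmin) = potential (dead s) + \<beta> * hmin * f"
  proof -
    have "(\<Sum>(v, x)\<leftarrow>xs. h x + \<beta> * hmin) = potential xs + \<beta> * hmin * length xs" for xs :: "(nat \<times> int) list"
      by (induction xs) (auto simp: potential_def algebra_simps)
    then show ?thesis by (simp add: len)
  qed
  moreover have "0 \<le> (\<Sum>(v, x)\<leftarrow>stack s. q x * card {u \<in> unvisited s. {v, u} \<in> queried s})"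
    using types by (intro sum_list_nonneg) (auto intro!: mult_nonneg_nonneg q_nonneg)
  ultimately have "potential (dead s) + \<beta> * hmin * f \<le> debt s" by (simp add: debt_def)
  moreover have "potential (stack s) \<le> (\<Sum>p\<leftarrow>stack s. 1)"
    unfolding potential_def using types h by (intro sum_list_mono) auto
  moreover have "(\<Sum>p\<leftarrow>stack s. 1 :: real) = length (stack s)" by (simp add: sum_list_triv)
  moreover have "gain s + debt s \<le> potential (stack s) + potential (dead s)" using v by (simp add: valid_def)
  ultimately show ?thesis using s(2) by linarith
qed

lemma linked_sum_le:
  fixes xs :: "(nat \<times> int) list"
  shows
  "successively (\<lambda>(u, y) (v, x). W {u, v} \<le> eps * (real_of_int y - real_of_int x + real L)) xs \<Longrightarrow> xs \<noteq> [] \<Longrightarrow>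
   (\<Sum>i<length xs - 1. W {map fst xs ! i, map fst xs ! Suc i}) \<le> eps * (real_of_int (snd (hd xs)) - real_of_int (snd (last xs)) + real L * real (length xs - 1))"
proof (induction xs rule: induct_list012)
  case (3 p p' xs)
  obtain u y v x where p: "p = (u, y)" "p' = (v, x)" by (cases p, cases p')
  have "(\<Sum>i<length (p # p' # xs) - 1. W {map fst (p # p' # xs) ! i, map fst (p # p' # xs) ! Suc i})
     = W {u, v} + (\<Sum>i<length (p' # xs) - 1. W {map fst (p' # xs) ! i, map fst (p' # xs) ! Suc i})"
    by (simp add: p sum.lessThan_Suc_shift del: sum.lessThan_Suc)
  also have "\<dots> \<le> eps * (real_of_int y - real_of_int x + real L) + eps * (real_of_int (snd (hd (p' # xs))) - real_of_int (snd (last (p' # xs))) + real L * real (length (p' # xs) - 1))"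
    using 3 p by (intro add_mono) auto
  finally show ?case by (simp add: p algebra_simps)
qed auto

text \<open>A stack that stays short forces a very negative gain, which Markov's inequality for
  \<open>exp (- \<theta> * gain)\<close> makes unlikely, since its expectation is at most 1. A stack
  of length at least \<open>k\<close> is a light path: its net rise is below \<open>N\<close>, so it
  adds at most \<open>eps * N / (k - 1)\<close> to the average.\<close>

lemma long_light_path:
  fixes \<beta> hmin lam :: real
  assumes q: "\<And>x. 1 \<le> x \<Longrightarrow> x < int N \<Longrightarrow> (1 + \<beta>) * h x \<le> q x * (n - k - f)"
    and h: "\<And>x. 1 \<le> x \<Longrightarrow> x < int N \<Longrightarrow> hmin \<le> h x \<and> h x \<le> 1" and \<beta>: "0 \<le> \<beta>"
    and k: "2 \<le> k" and lam: "eps * L + eps * N / (real k - 1) \<le> lam"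
  shows "measure (weight_space n) {W \<in> space (weight_space n). Lmax n lam W < k - 1} \<le> exp (- \<theta> * (\<beta> * hmin * f - k))"
proof -
  interpret W: prob_space "weight_space n" by (rule prob_space_weight_space[OF n])
  define t where "t = remaining start"
  define G where "G W = ennreal (exp (- \<theta> * gain (run t start W)))" for W
  define c where "c = exp (\<theta> * (\<beta> * hmin * f - k))"
  have [measurable]: "G \<in> borel_measurable (weight_space n)"
    unfolding G_def using run_measurable[OF valid_start]
    by (rule measurable_compose[where g = "\<lambda>s. ennreal (exp (- \<theta> * gain s))"]) simp
  have "{W \<in> space (weight_space n). Lmax n lam W < k - 1} \<subseteq> {W \<in> space (weight_space n). 1 \<le> ennreal (1 / c) * G W}"
  proof safe
    fix W assume W: "Lmax n lam W < k - 1"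
    define s where "s = run t start W"
    have s: "halted s" "valid s" "linked W s"
      using run_invariants[OF valid_start linked_start, of t W] by (auto simp: s_def t_def)
    have "length (stack s) < k"
    proof (rule ccontr)
      assume "\<not> length (stack s) < k"
      then have len: "k \<le> length (stack s)" by simp
      define xs where "xs = map fst (stack s)"
      have ne: "stack s \<noteq> []" using len k by auto
      have path: "is_path n xs" using s(2) len k by (auto simp: is_path_def xs_def valid_def)
      have M: "path_len xs = length (stack s) - 1" by (simp add: path_len_def xs_def)
      have "snd ` set (stack s) \<subseteq> {1..<int N}" using s(2) by (simp add: valid_def)
      then have "snd (last (stack s)) \<in> {1..<int N}" "snd (hd (stack s)) \<in> {1..<int N}"
        using last_in_set[OF ne] hd_in_set[OF ne] by blast+
      then have "real_of_int (snd (hd (stack s))) - real_of_int (snd (last (stack s))) \<le> N" by auto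
      then have "(\<Sum>i<path_len xs. W {xs ! i, xs ! Suc i}) \<le> eps * (N + real L * path_len xs)"
        using linked_sum_le[of W "stack s"] s(3) ne eps
          mult_left_mono[of "real_of_int (snd (hd (stack s))) - real_of_int (snd (last (stack s)))" N eps]
        unfolding M unfolding linked_def xs_def distrib_left by linarith
      then have "avg_weight W xs \<le> eps * (N + real L * path_len xs) / path_len xs"
        unfolding avg_weight_def by (rule divide_right_mono) simp
      also have "\<dots> = eps * L + eps * N / path_len xs" using M len k by (simp add: field_simps)
      also have "\<dots> \<le> eps * L + eps * N / (real k - 1)"
        using M len k eps by (intro add_left_mono divide_left_mono) auto
      finally have "path_len xs \<le> Lmax n lam W" using lam by (intro Lmax_ge[OF path]) simp
      then show False using W M len by simp
    qed
    then have "gain s \<le> k - \<beta> * hmin * f" by (rule gain_le[OF s(2,1) _ q h \<beta>])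
    then have "\<theta> * (\<beta> * hmin * f - k) \<le> - \<theta> * gain s"
      using mult_left_mono[of "gain s" "k - \<beta> * hmin * f" \<theta>] \<theta> by (simp add: algebra_simps)
    then have "c \<le> exp (- \<theta> * gain s)" by (simp add: c_def)
    then have "1 \<le> 1 / c * exp (- \<theta> * gain s)" by (simp add: c_def field_simps)
    then show "1 \<le> ennreal (1 / c) * G W"
      by (simp add: G_def s_def c_def ennreal_mult'[symmetric] del: ennreal_1 flip: ennreal_1)
  qed
  then have "emeasure (weight_space n) {W \<in> space (weight_space n). Lmax n lam W < k - 1}
     \<le> emeasure (weight_space n) {W \<in> space (weight_space n). 1 \<le> ennreal (1 / c) * G W}"
    by (intro emeasure_mono) measurable
  also have "\<dots> \<le> ennreal (1 / c) * (\<integral>\<^sup>+W. G W * indicator (space (weight_space n)) W \<partial>weight_space n)"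
    using nn_integral_Markov_inequality[of G "space (weight_space n)" "weight_space n" "ennreal (1 / c)"] by simp
  also have "\<dots> \<le> ennreal (1 / c) * 1"
    using run_supermartingale[OF valid_start, of t] 
    by (intro mult_left_mono) (simp_all add: G_def start_def)
  finally show ?thesis
    by (simp add: W.emeasure_eq_measure c_def exp_minus inverse_eq_divide)
qed

end

section \<open>Choice of the parameters\<close>

text \<open>Because \<open>(1 + t) * (1 - t + t^2) = 1 + t^3\<close> is at least 1.\<close>

lemma exp_minus_le: "0 \<le> t \<Longrightarrow> exp (- t) \<le> 1 - t + t\<^sup>2" for t :: real
proof -
  assume t: "0 \<le> t"
  have "1 \<le> (1 + t) * (1 - t + t\<^sup>2)" using t by (simp add: algebra_simps power2_eq_square)
  also have "\<dots> \<le> exp t * (1 - t + t\<^sup>2)"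
  proof (rule mult_right_mono)
    have "0 \<le> (1 - t / 2)\<^sup>2 + 3 / 4 * t\<^sup>2" by simp
    also have "\<dots> = 1 - t + t\<^sup>2" by (simp add: power2_eq_square algebra_simps)
    finally show "0 \<le> 1 - t + t\<^sup>2" .
  qed (rule exp_ge_add_one_self)
  finally show ?thesis by (simp add: exp_minus field_simps)
qed

lemma emeasure_weight_law_interval_ge:
  assumes "0 < n" "0 \<le> a" "a \<le> b"
  shows "ennreal ((b - a) / n * exp (- (b / n))) \<le> emeasure (weight_law n) {a<..b}"
proof -
  have "ennreal ((b - a) / n * exp (- (b / n))) = (\<integral>\<^sup>+x. ennreal (exp (- (b / n)) / n) * indicator {a<..b} x \<partial>lborel)"
    using assms by (subst nn_integral_cmult_indicator) (auto simp: ennreal_mult'[symmetric] mult.commute)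
  also have "\<dots> \<le> (\<integral>\<^sup>+x. ennreal (exponential_density (1 / real n) x) * indicator {a<..b} x \<partial>lborel)"
    using assms by (intro nn_integral_mono) (auto simp: exponential_density_def divide_simps indicator_def intro!: ennreal_leI)
  also have "\<dots> = emeasure (weight_law n) {a<..b}"
    unfolding weight_law_def by (subst emeasure_density) auto
  finally show ?thesis .
qed

lemma prob_outcome_ge:
  assumes n: "0 < n" and eps: "0 < eps" and x: "1 \<le> x" "x < int N" and y: "1 \<le> y" "y < int N" "x - int L < y"
  shows "eps / n * exp (- ((N + L) * eps / n)) \<le> measure (weight_law n) {w. outcome L N eps x w = y}"
proof -
  interpret law: prob_space "weight_law n" by (rule prob_space_weight_law) fact
  define j where "j = real_of_int (y - x + int L)"
  have j: "1 \<le> j" "j \<le> N + L" using x y by (auto simp: j_def)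
  have sub: "{eps * (j - 1)<..eps * j} \<subseteq> {w. outcome L N eps x w = y}"
  proof
    fix w assume "w \<in> {eps * (j - 1)<..eps * j}"
    then have w: "eps * (j - 1) < w" "w \<le> eps * j" by auto
    have "0 \<le> eps * (j - 1)" using eps j by simp
    then have "0 < w" using w by linarith
    moreover have "j - 1 < w / eps" "w / eps \<le> j" using w eps by (simp_all add: field_simps)
    then have "\<lceil>w / eps\<rceil> = y - x + int L" unfolding j_def by (simp add: ceiling_eq_iff)
    ultimately show "w \<in> {w. outcome L N eps x w = y}" using y by (simp add: outcome_def)
  qed
  have "eps * j \<le> (N + L) * eps" using mult_left_mono[OF j(2), of eps] eps by (simp add: mult.commute)
  then have e1: "exp (- ((N + L) * eps / n)) \<le> exp (- (eps * j / n))" by (simp add: divide_right_mono)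
  have e2: "eps * j - eps * (j - 1) = eps" by (simp add: algebra_simps)
  have "eps / n * exp (- ((N + L) * eps / n)) \<le> (eps * j - eps * (j - 1)) / n * exp (- (eps * j / n))"
    unfolding e2 using e1 eps by (intro mult_left_mono) auto
  also have "\<dots> \<le> measure (weight_law n) {eps * (j - 1)<..eps * j}"
  proof -
    have "0 \<le> eps * (j - 1)" "eps * (j - 1) \<le> eps * j" using eps j by auto
    from emeasure_weight_law_interval_ge[OF n this] show ?thesis
      unfolding law.emeasure_eq_measure by (subst (asm) ennreal_le_iff) auto
  qed
  also have "\<dots> \<le> measure (weight_law n) {w. outcome L N eps x w = y}"
    using sub by (intro law.finite_measure_mono) auto
  finally show ?thesis by simp
qed

text \<open>The supersolution surplus \<open>1 + \<eta> / 4\<close> pays for two losses: a factor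
  \<open>1 - \<eta> / 32\<close> for the exponential density below \<open>1 / n\<close>, and a
  factor \<open>1 - \<theta>\<close> with \<open>\<theta> = \<eta> / 32\<close> for the quadratic
  term of the exponential, where \<open>h y \<le> 1\<close> is used. What is left still covers the
  charge factor \<open>1 + \<eta> / 8\<close>.\<close>

lemma query_bound:
  fixes h :: "int \<Rightarrow> real"
  assumes n: "0 < n" and eps: "0 < eps" and N: "2 \<le> N" and x: "1 \<le> x" "x < int N"
    and h: "\<And>y. 1 \<le> y \<Longrightarrow> y < int N \<Longrightarrow> 0 \<le> h y \<and> h y \<le> 1"
    and sub: "(1 + \<eta> / 4) * h x \<le> eps * (\<Sum>y\<in>{y\<in>{1..<int N}. x - int L < y}. h y)"
    and \<eta>: "0 < \<eta>" "\<eta> \<le> 1" and large: "1 - \<eta> / 32 \<le> exp (- ((N + L) * eps / n))"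
  shows "(\<Sum>y\<in>{0..<int N}. measure (weight_law n) {w. outcome L N eps x w = y} *
         exp (\<eta> / 32 * ((1 + \<eta> / 8) * h x / n - (if y = 0 then 0 else h y)))) \<le> 1"
proof -
  interpret law: prob_space "weight_law n" by (rule prob_space_weight_law) fact
  define \<theta> where "\<theta> = \<eta> / 32"
  define p where "p y = measure (weight_law n) {w. outcome L N eps x w = y}" for y
  define g where "g y = (if y = 0 then 0 else h y)" for y
  define S where "S = {y\<in>{1..<int N}. x - int L < y}"
  have meas: "{w. outcome L N eps x w = y} \<in> sets (weight_law n)" for y
    using measurable_sets[OF outcome_measurable[of L N eps x], of "{y}"] by (simp add: vimage_def)
  have "(\<Sum>y\<in>{0..<int N}. p y) = measure (weight_law n) (\<Union>y\<in>{0..<int N}. {w. outcome L N eps x w = y})"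
    unfolding p_def using meas
    by (intro law.finite_measure_finite_Union[symmetric]) (auto simp: disjoint_family_on_def)
  also have "(\<Union>y\<in>{0..<int N}. {w. outcome L N eps x w = y}) = space (weight_law n)"
    using outcome_range[OF N] by auto
  finally have p1: "(\<Sum>y\<in>{0..<int N}. p y) = 1" using law.prob_space by simp
  have p0: "0 \<le> p y" for y by (simp add: p_def)
  have g: "0 \<le> g y" "g y \<le> 1" if "y \<in> {0..<int N}" for y using that h[of y] by (auto simp: g_def)
  have \<theta>: "0 < \<theta>" "\<theta> \<le> 1" using \<eta> by (auto simp: \<theta>_def)
  define P where "P = (\<Sum>y\<in>{0..<int N}. p y * g y)"
  have "(\<Sum>y\<in>{0..<int N}. p y * exp (- (\<theta> * g y))) \<le> (\<Sum>y\<in>{0..<int N}. p y - \<theta> * (1 - \<theta>) * (p y * g y))"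
  proof (rule sum_mono)
    fix y assume y: "y \<in> {0..<int N}"
    have "exp (- (\<theta> * g y)) \<le> 1 - \<theta> * g y + (\<theta> * g y)\<^sup>2" using g[OF y] \<theta> by (intro exp_minus_le) auto
    also have "(\<theta> * g y)\<^sup>2 \<le> \<theta>\<^sup>2 * g y"
    proof -
      have "g y * g y \<le> g y" using g[OF y] by (simp add: mult_left_le)
      then have "\<theta>\<^sup>2 * (g y * g y) \<le> \<theta>\<^sup>2 * g y" by (rule mult_left_mono) simp
      then show ?thesis by (simp add: power2_eq_square mult_ac)
    qed
    finally have "exp (- (\<theta> * g y)) \<le> 1 - \<theta> * (1 - \<theta>) * g y" by (simp add: power2_eq_square algebra_simps)
    then have "p y * exp (- (\<theta> * g y)) \<le> p y * (1 - \<theta> * (1 - \<theta>) * g y)" using p0 by (rule mult_left_mono)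
    then show "p y * exp (- (\<theta> * g y)) \<le> p y - \<theta> * (1 - \<theta>) * (p y * g y)" by (simp add: algebra_simps)
  qed
  also have "\<dots> = 1 + - (\<theta> * (1 - \<theta>) * P)"
    by (simp add: sum_subtractf p1 P_def sum_distrib_left)
  also have "\<dots> \<le> exp (- (\<theta> * (1 - \<theta>) * P))" by (rule exp_ge_add_one_self)
  finally have E: "(\<Sum>y\<in>{0..<int N}. p y * exp (- (\<theta> * g y))) \<le> exp (- (\<theta> * (1 - \<theta>) * P))" .
  have hx: "0 \<le> h x" using h[OF x] by simp
  have "(1 - \<eta> / 32) * ((1 + \<eta> / 4) * h x) / n \<le> exp (- ((N + L) * eps / n)) * (eps * (\<Sum>y\<in>S. h y)) / n"
    using hx \<eta> by (intro divide_right_mono mult_mono[OF large sub[folded S_def]]) auto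
  also have "\<dots> = (\<Sum>y\<in>S. eps / n * exp (- ((N + L) * eps / n)) * h y)"
    by (subst sum_distrib_left[symmetric]) simp
  also have "\<dots> \<le> (\<Sum>y\<in>S. p y * g y)"
  proof (rule sum_mono)
    fix y assume "y \<in> S"
    then have y: "1 \<le> y" "y < int N" "x - int L < y" by (auto simp: S_def)
    show "eps / n * exp (- ((N + L) * eps / n)) * h y \<le> p y * g y"
      using prob_outcome_ge[OF n eps x y] h[OF y(1,2)] y(1) unfolding p_def g_def
      by (intro mult_mono) auto
  qed
  also have "\<dots> \<le> P"
    unfolding P_def using p0 g by (intro sum_mono2) (auto simp: S_def)
  finally have P: "(1 - \<eta> / 32) * ((1 + \<eta> / 4) * h x) / n \<le> P" .
  have "(1 + \<eta> / 8) * h x / n \<le> (1 - \<theta>) * ((1 - \<eta> / 32) * ((1 + \<eta> / 4) * h x) / n)"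
  proof -
    have "\<eta> * \<eta> \<le> \<eta>" "\<eta> * (\<eta> * \<eta>) \<ge> 0" using \<eta> by (auto simp: mult_left_le)
    moreover have "(1 - \<theta>) * ((1 - \<eta> / 32) * (1 + \<eta> / 4))
        = 1 + 3 / 16 * \<eta> - 15 / 1024 * (\<eta> * \<eta>) + \<eta> * (\<eta> * \<eta>) / 4096"
      by (simp add: \<theta>_def field_simps)
    ultimately have "1 + \<eta> / 8 \<le> (1 - \<theta>) * ((1 - \<eta> / 32) * (1 + \<eta> / 4))" using \<eta> by linarith
    then have "(1 + \<eta> / 8) * (h x / n) \<le> (1 - \<theta>) * ((1 - \<eta> / 32) * (1 + \<eta> / 4)) * (h x / n)"
      using hx by (intro mult_right_mono) auto
    then show ?thesis by (simp add: mult_ac)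
  qed
  also have "\<dots> \<le> (1 - \<theta>) * P" using P \<theta> by (intro mult_left_mono) auto
  finally have Q: "(1 + \<eta> / 8) * h x / n \<le> (1 - \<theta>) * P" .
  have "(\<Sum>y\<in>{0..<int N}. p y * exp (\<theta> * ((1 + \<eta> / 8) * h x / n - g y)))
      = exp (\<theta> * ((1 + \<eta> / 8) * h x / n)) * (\<Sum>y\<in>{0..<int N}. p y * exp (- (\<theta> * g y)))"
  proof -
    have "exp (\<theta> * ((1 + \<eta> / 8) * h x / n - g y)) = exp (\<theta> * ((1 + \<eta> / 8) * h x / n)) * exp (- (\<theta> * g y))" for y
      unfolding exp_add[symmetric] right_diff_distrib[of \<theta>] by simp
    then show ?thesis unfolding sum_distrib_left by (simp only: mult.left_commute)
  qed
  also have "\<dots> \<le> exp (\<theta> * ((1 - \<theta>) * P)) * exp (- (\<theta> * (1 - \<theta>) * P))"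
  proof (rule mult_mono[OF _ E])
    have "\<theta> * ((1 + \<eta> / 8) * h x / n) \<le> \<theta> * ((1 - \<theta>) * P)"
      using Q by (rule mult_left_mono) (use \<theta> in simp)
    then show "exp (\<theta> * ((1 + \<eta> / 8) * h x / n)) \<le> exp (\<theta> * ((1 - \<theta>) * P))"
      by (simp only: exp_le_cancel_iff)
  qed (auto intro!: sum_nonneg mult_nonneg_nonneg p0)
  also have "\<dots> = 1" by (simp add: exp_add[symmetric] mult_ac)
  finally show ?thesis by (simp add: p_def g_def \<theta>_def)
qed

section \<open>The half wave on the search band\<close>

context
  fixes m L N :: nat and u :: real
  assumes m: "4 \<le> m" and L_def: "L = m\<^sup>2" and N_def: "N = m * L" and u_def: "u = pi / m"
begin

text \<open>\<open>u / L * N = pi\<close> makes the band exactly half a period, with zeros of the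
  sine at heights 0 and \<open>N\<close>. The choice \<open>L = m^2\<close> puts the discretization
  error \<open>2 / L\<close> at the same order as \<open>u^2\<close>.\<close>

lemma mL: "2 \<le> L" "4 \<le> L" "0 < u" "u \<le> 1" "u / L * N = pi" "L < N"
proof -
  have "4 * 4 \<le> m * m" using m by (intro mult_mono) auto
  then show "2 \<le> L" "4 \<le> L" by (simp_all add: L_def power2_eq_square)
  then show "L < N" using m by (simp add: N_def)
  show "0 < u" "u \<le> 1" "u / L * N = pi"
    using m pi_less_4 \<open>2 \<le> L\<close> by (simp_all add: u_def N_def)
qed

lemma wave_eq: "0 \<le> x \<Longrightarrow> wave L u 0 x = ratio L u ^ nat x * sin (u / L * x)"
  by (simp add: wave_def power_int_def)

lemma wave_angle:
  assumes "0 \<le> x" "x \<le> int N"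
  shows "0 \<le> u / L * x" "u / L * x \<le> pi"
proof -
  have "u / L * x \<le> u / L * N" using assms mL by (intro mult_left_mono) auto
  then show "u / L * x \<le> pi" using mL(5) by simp
qed (use assms mL in auto)

text \<open>The sine is smallest next to the ends of the band, where it is at least half of its
  angle \<open>pi / m^3\<close>; the power of \<open>ratio\<close> is smallest at the top, after
  \<open>m\<close> blocks.\<close>

lemma wave_bounds:
  assumes x: "1 \<le> x" "x < int N"
  shows "exp (- (4 * real m)) / real m ^ 3 \<le> wave L u 0 x" "wave L u 0 x \<le> 1"
proof -
  note w = mL(1,3,4)
  have r: "0 \<le> ratio L u" "ratio L u \<le> 1" using ratio_pos[OF w] ratio_le_one[OF w] by auto
  define \<phi> where "\<phi> = u / L"
  have \<phi>: "0 < \<phi>" "\<phi> \<le> 1" using angle_pos[OF w] by (auto simp: \<phi>_def)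
  have "sin \<phi> \<le> sin (\<phi> * x)"
  proof -
    have 1: "\<phi> \<le> \<phi> * x" using x \<phi> by simp
    have "real_of_int x + 1 \<le> N" using x by linarith
    then have "\<phi> * (real_of_int x + 1) \<le> \<phi> * N" using \<phi> by (intro mult_left_mono) auto
    moreover have "\<phi> * N = pi" using mL(5) by (simp add: \<phi>_def)
    ultimately have 2: "\<phi> * x \<le> pi - \<phi>" by (simp add: distrib_left)
    show ?thesis
    proof (cases "\<phi> * x \<le> pi / 2")
      case True
      then show ?thesis using 1 \<phi> pi_gt3 by (intro sin_monotone_2pi_le) auto
    next
      case False
      then have "sin \<phi> \<le> sin (pi - \<phi> * x)" using 2 \<phi> pi_gt3 by (intro sin_monotone_2pi_le) auto
      then show ?thesis by simp
    qed
  qed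
  moreover have "1 / real m ^ 3 \<le> sin \<phi>"
  proof -
    have "\<phi> ^ 3 \<le> \<phi>" using \<phi> by (metis less_imp_le power_decreasing power_one_right one_le_numeral)
    then have "\<phi> / 2 \<le> sin \<phi>" using sin_ge_cubic[of \<phi>] \<phi> by simp
    moreover have "\<phi> = pi / real m ^ 3" by (simp add: \<phi>_def u_def L_def power2_eq_square power3_eq_cube)
    moreover have "1 / real m ^ 3 \<le> pi / 2 / real m ^ 3" using pi_gt3 by (intro divide_right_mono) auto
    ultimately show ?thesis by simp
  qed
  moreover have "exp (- (4 * real m)) \<le> ratio L u ^ nat x"
  proof -
    have "exp (- (4 * real m)) \<le> ratio L u ^ N"
      unfolding N_def using ratio_power_ge[OF w mL(2), of m] by simp
    also have "\<dots> \<le> ratio L u ^ nat x" using r x by (intro power_decreasing) auto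
    finally show ?thesis .
  qed
  ultimately have "exp (- (4 * real m)) * (1 / real m ^ 3) \<le> ratio L u ^ nat x * sin (\<phi> * x)"
    using r by (intro mult_mono) auto
  then show "exp (- (4 * real m)) / real m ^ 3 \<le> wave L u 0 x" using x by (simp add: wave_eq \<phi>_def)
  have "ratio L u ^ nat x * sin (u / L * x) \<le> 1 * 1"
    using r x wave_angle[of x] by (intro mult_mono power_le_one sin_ge_zero) auto
  then show "wave L u 0 x \<le> 1" using x by (simp add: wave_eq)
qed

text \<open>Stopping the telescoped sum at the zero \<open>N\<close> leaves no boundary term. The
  terms at heights \<open>- L\<close> to 0 are nonpositive and may be dropped; the missing terms
  between \<open>N - L\<close> and \<open>N\<close> are nonnegative and may be added.\<close>

lemma wave_subsolution:
  assumes x: "1 \<le> x" "x < int N"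
  shows "wave L u 0 x \<le> rate L u * (\<Sum>y\<in>{y\<in>{1..<int N}. x - int L < y}. wave L u 0 y)"
proof -
  note w = mL(1,3,4)
  have top: "wave L u 0 (int N) = 0" using mL(5) by (simp add: wave_eq)
  have nonneg: "0 \<le> wave L u 0 y" if "0 \<le> y" "y \<le> int N" for y
    using that wave_angle[OF that] ratio_pos[OF w] by (simp add: wave_eq sin_ge_zero)
  have nonpos: "wave L u 0 y \<le> 0" if "- int L \<le> y" "y \<le> 0" for y
  proof -
    have "0 \<le> sin (u / L * real_of_int (- y))"
      using that mL(6) by (intro sin_ge_zero wave_angle) auto
    then show ?thesis using ratio_pos[OF w] by (simp add: wave_def mult_nonneg_nonpos)
  qed
  have "wave L u 0 x = rate L u * (\<Sum>y\<in>{x + 1 - int L..int N - int L}. wave L u 0 y)"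
    using wave_telescope'[OF w, of x "int N" 0] x top by simp
  also have "\<dots> \<le> rate L u * (\<Sum>y\<in>{y\<in>{1..<int N}. x - int L < y}. wave L u 0 y)"
  proof (rule mult_left_mono)
    have "(\<Sum>y\<in>{x + 1 - int L..int N - int L}. wave L u 0 y)
       = (\<Sum>y\<in>{x + 1 - int L..int N - int L} \<inter> {1..}. wave L u 0 y) + (\<Sum>y\<in>{x + 1 - int L..int N - int L} - {1..}. wave L u 0 y)"
      by (rule sum.Int_Diff) simp
    also have "\<dots> \<le> (\<Sum>y\<in>{x + 1 - int L..int N - int L} \<inter> {1..}. wave L u 0 y) + 0"
      using x by (intro add_left_mono sum_nonpos nonpos) auto
    also have "\<dots> \<le> (\<Sum>y\<in>{y\<in>{1..<int N}. x - int L < y}. wave L u 0 y)"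
    proof -
      have "finite {y\<in>{1..<int N}. x - int L < y}"
        by (rule finite_subset[of _ "{1..<int N}"]) auto
      then have "(\<Sum>y\<in>{x + 1 - int L..int N - int L} \<inter> {1..}. wave L u 0 y) \<le> (\<Sum>y\<in>{y\<in>{1..<int N}. x - int L < y}. wave L u 0 y)"
        by (rule sum_mono2) (use mL(1) in \<open>auto intro!: nonneg\<close>)
      then show ?thesis by simp
    qed
    finally show "(\<Sum>y\<in>{x + 1 - int L..int N - int L}. wave L u 0 y) \<le> (\<Sum>y\<in>{y\<in>{1..<int N}. x - int L < y}. wave L u 0 y)" .
  qed (use rate_pos[OF w] in simp)
  finally show ?thesis .
qed

text \<open>As pi is below 4, \<open>u^2 + 2 / L\<close> is at most \<open>18 / m^2\<close>, and 144
  is 8 times 18. So the rate needed by the wave is smaller than the cell width of slope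
  \<open>1/e + \<eta>/2\<close> by a factor \<open>1 + \<eta>/4\<close>.\<close>

lemma rate_le_eta:
  assumes \<eta>: "0 < \<eta>" "\<eta> \<le> 1" and m12: "144 \<le> \<eta> * (real m)\<^sup>2"
  shows "(1 + \<eta> / 4) * rate L u \<le> (exp (-1) + \<eta> / 2) / L"
proof -
  note w = mL(1,3,4)
  define t where "t = 18 / (real m)\<^sup>2"
  have m0: "0 < (real m)\<^sup>2" using m by simp
  have t: "0 \<le> t" "t \<le> \<eta> / 8" using m12 m0 by (auto simp: t_def field_simps)
  have "u\<^sup>2 \<le> (4 / m)\<^sup>2" unfolding u_def using pi_less_4 m by (intro power_mono divide_right_mono) auto
  then have "u\<^sup>2 + 2 / L \<le> t" by (simp add: t_def L_def power_divide)
  then have "exp (u\<^sup>2 + 2 / L) \<le> exp t" by simp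
  also have "\<dots> \<le> 1 + 2 * t"
    using exp_bound_lemma[of t] t \<eta> by simp
  finally have e: "exp (u\<^sup>2 + 2 / L) \<le> 1 + \<eta> / 4" using t by simp
  have "L * rate L u \<le> exp (-1) * exp (u\<^sup>2 + 2 / L)" by (rule rate_le'[OF w])
  also have "\<dots> \<le> exp (-1) * (1 + \<eta> / 4)" using e by (intro mult_left_mono) auto
  finally have "(1 + \<eta> / 4) * (L * rate L u) \<le> (1 + \<eta> / 4) * (exp (-1) * (1 + \<eta> / 4))"
    using \<eta> by (intro mult_left_mono) auto
  also have "\<dots> = exp (-1) + exp (-1) * (\<eta> / 2 + \<eta> * \<eta> / 16)" by (simp add: field_simps)
  also have "\<dots> \<le> exp (-1) + (1 / 2) * (\<eta> / 2 + \<eta> / 16)"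
  proof -
    have "exp (-1) \<le> (1 / 2 :: real)" using exp_ge_add_one_self[of "1 :: real"] by (simp add: exp_minus field_simps)
    moreover have "\<eta> * \<eta> \<le> \<eta>" using \<eta> by (simp add: mult_left_le)
    ultimately show ?thesis using \<eta> by (intro add_left_mono mult_mono) auto
  qed
  finally show ?thesis using mL(1) \<eta> by (simp add: field_simps)
qed

end

section \<open>Constants of the search and the lower bound\<close>

lemma eventually_long_light_path:
  fixes \<eta> \<kappa> \<delta> :: real and m :: nat
  assumes \<eta>: "0 < \<eta>" "\<eta> \<le> 1" and m: "4 \<le> m" "144 \<le> \<eta> * (real m)\<^sup>2"
    and \<kappa>: "\<kappa> = \<eta>\<^sup>2 * (exp (- (4 * real m)) / real m ^ 3) / 3200"
    and \<delta>: "\<delta> < \<kappa>"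
  shows "(\<lambda>n. measure (weight_space n) {W \<in> space (weight_space n). Lmax n (exp (-1) + \<eta>) W < n * \<delta>}) \<longlonglongrightarrow> 0"
proof (rule tendsto_sandwich[OF always_eventually _ tendsto_const])
  define L where "L = m\<^sup>2"
  define N where "N = m * L"
  define u where "u = pi / m"
  \<comment> \<open>Half of \<eta> goes into the slope \<open>eps * L\<close>; the other half
    absorbs the net rise of the path.\<close>
  define eps where "eps = (exp (-1) + \<eta> / 2) / L"
  define h where "h = wave L u 0"
  define hmin where "hmin = exp (- (4 * real m)) / real m ^ 3"
  \<comment> \<open>The search uses at most \<open>\<eta> n / 50\<close> vertices. The charge factor
    \<open>1 + \<eta>/8\<close>, multiplied by the remaining fraction \<open>1 - \<eta>/50\<close>,
    still leaves \<open>1 + \<eta>/16\<close>, whence \<beta>.\<close>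
  define \<beta> where "\<beta> = \<eta> / 16"
  define f where "f n = nat \<lfloor>\<eta> / 100 * real n\<rfloor>" for n :: nat
  define k where "k n = nat \<lfloor>\<kappa> * real n\<rfloor>" for n :: nat
  note c = m(1) L_def N_def u_def
  have L: "2 \<le> L" "L < N" using mL[OF c] by auto
  have eps: "0 < eps" unfolding eps_def using L \<eta> by (intro divide_pos_pos add_pos_pos) auto
  have hmin: "0 < hmin" "hmin \<le> 1"
  proof -
    show "0 < hmin" using m by (simp add: hmin_def)
    have "hmin \<le> h 1" "h 1 \<le> 1" unfolding hmin_def h_def using wave_bounds[OF c, of 1] L by auto
    then show "hmin \<le> 1" by simp
  qed
  \<comment> \<open>With \<open>\<beta> = \<eta>/16\<close> and \<open>f\<close> about
    \<open>\<eta> n / 100\<close>, the surplus \<open>\<beta> * hmin * f\<close> is about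
    \<open>2 \<kappa> n\<close>, twice the stack length \<open>k\<close> that it has to
    exceed.\<close>
  have \<kappa>': "\<kappa> = \<eta> * hmin / 3200 * \<eta>" by (simp add: \<kappa> hmin_def power2_eq_square)
  have \<kappa>0: "0 < \<kappa>" using \<eta> hmin by (simp add: \<kappa>')
  have \<kappa>1: "\<kappa> \<le> \<eta> / 100"
  proof -
    have "\<eta> * hmin \<le> 1 * 1" using \<eta> hmin by (intro mult_mono) auto
    then have "\<eta> * hmin / 3200 * \<eta> \<le> 1 / 100 * \<eta>" using \<eta> by (intro mult_right_mono) auto
    then show ?thesis by (simp add: \<kappa>')
  qed
  show "(\<lambda>n :: nat. exp (- (\<eta> / 32) * (\<kappa> * n - 1))) \<longlonglongrightarrow> 0"
    using \<eta>(1) \<kappa>0 by real_asymp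
  have k_lim: "filterlim k at_top sequentially" unfolding k_def using \<kappa>0 by real_asymp
  have "(\<lambda>n. eps * N / (real (k n) - 1)) \<longlonglongrightarrow> 0"
  proof -
    have "(\<lambda>j :: nat. eps * N / (real j - 1)) \<longlonglongrightarrow> 0" by real_asymp
    then show ?thesis by (rule filterlim_compose[OF _ k_lim])
  qed
  then have ev1: "eventually (\<lambda>n. eps * N / (real (k n) - 1) < \<eta> / 2) sequentially"
    by (rule order_tendstoD) (use \<eta> in simp)
  have "(\<lambda>n :: nat. exp (- ((N + L) * eps / n))) \<longlonglongrightarrow> 1" by real_asymp
  then have ev2: "eventually (\<lambda>n :: nat. 1 - \<eta> / 32 < exp (- ((N + L) * eps / n))) sequentially"
    by (rule order_tendstoD) (use \<eta> in simp)
  have ev3: "eventually (\<lambda>n. 2 \<le> k n) sequentially" using k_lim by (simp add: filterlim_at_top)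
  have ev4: "eventually (\<lambda>n :: nat. n * \<delta> \<le> \<kappa> * n - 2) sequentially"
    using \<delta> by real_asymp
  show "eventually (\<lambda>n. measure (weight_space n) {W \<in> space (weight_space n). Lmax n (exp (-1) + \<eta>) W < n * \<delta>}
      \<le> exp (- (\<eta> / 32) * (\<kappa> * n - 1))) sequentially"
    using ev1 ev2 ev3 ev4 eventually_gt_at_top[of 0]
  proof eventually_elim
    case (elim n)
    have n: "0 < n" using elim by simp
    interpret W: prob_space "weight_space n" by (rule prob_space_weight_space[OF n])
    have fn: "f n \<le> \<eta> / 100 * n" "\<eta> / 100 * n - 1 \<le> f n"
    proof -
      show "f n \<le> \<eta> / 100 * n" unfolding f_def by (rule of_nat_floor) (use \<eta> in simp)
      show "\<eta> / 100 * n - 1 \<le> f n" unfolding f_def by linarith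
    qed
    have kn: "k n \<le> \<kappa> * n" "\<kappa> * n - 1 \<le> k n"
    proof -
      show "k n \<le> \<kappa> * n" unfolding k_def by (rule of_nat_floor) (use \<kappa>0 in simp)
      show "\<kappa> * n - 1 \<le> k n" unfolding k_def by linarith
    qed
    have "\<kappa> * n \<le> \<eta> / 100 * n" using \<kappa>1 by (rule mult_right_mono) simp
    then have fk50: "f n + k n \<le> \<eta> / 50 * n" using fn kn by simp
    also have "\<dots> \<le> 1 * real n" using \<eta> by (intro mult_right_mono) auto
    finally have fk': "f n + k n \<le> n" by simp
    have bounds: "hmin \<le> h x" "h x \<le> 1" if "1 \<le> x" "x < int N" for x
      unfolding hmin_def h_def using wave_bounds[OF c that] by auto
    have h0: "0 \<le> h x" if "1 \<le> x" "x < int N" for x using bounds[OF that] hmin by simp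
    interpret depth_first_search n "k n" "f n" N L eps "\<eta> / 32" h "\<lambda>x. (1 + \<eta> / 8) * h x / n"
    proof
      show "0 < n" "2 \<le> N" "0 < eps" "0 < \<eta> / 32" "f n + k n \<le> n" using n L eps \<eta> fk' by auto
      fix x assume x: "1 \<le> x" "x < int N"
      show "0 \<le> h x" "0 \<le> (1 + \<eta> / 8) * h x / n" using h0[OF x] \<eta> by auto
      show "(\<Sum>y\<in>{0..<int N}. measure (weight_law n) {w. outcome L N eps x w = y} *
         exp (\<eta> / 32 * ((1 + \<eta> / 8) * h x / n - (if y = 0 then 0 else h y)))) \<le> 1"
      proof (rule query_bound[OF n eps _ x _ _ \<eta>])
        show "2 \<le> N" using L by simp
        show "0 \<le> h y \<and> h y \<le> 1" if "1 \<le> y" "y < int N" for y using h0[OF that] bounds[OF that] by simp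
        show "1 - \<eta> / 32 \<le> exp (- ((N + L) * eps / n))" using elim by simp
        have "(1 + \<eta> / 4) * h x \<le> (1 + \<eta> / 4) * (rate L u * (\<Sum>y\<in>{y\<in>{1..<int N}. x - int L < y}. h y))"
          unfolding h_def using wave_subsolution[OF c x] \<eta> by (intro mult_left_mono) auto
        also have "\<dots> = (1 + \<eta> / 4) * rate L u * (\<Sum>y\<in>{y\<in>{1..<int N}. x - int L < y}. h y)" by simp
        also have "\<dots> \<le> eps * (\<Sum>y\<in>{y\<in>{1..<int N}. x - int L < y}. h y)"
          unfolding eps_def using rate_le_eta[OF c \<eta> m(2)] h0 by (intro mult_right_mono sum_nonneg) auto
        finally show "(1 + \<eta> / 4) * h x \<le> eps * (\<Sum>y\<in>{y\<in>{1..<int N}. x - int L < y}. h y)" .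
      qed
    qed
    have "W.prob {W \<in> space (weight_space n). Lmax n (exp (-1) + \<eta>) W < n * \<delta>}
       \<le> W.prob {W \<in> space (weight_space n). Lmax n (exp (-1) + \<eta>) W < k n - 1}"
    proof (rule W.finite_measure_mono)
      have "n * \<delta> \<le> real (k n - 1)" using elim kn by (simp add: of_nat_diff)
      then show "{W \<in> space (weight_space n). Lmax n (exp (-1) + \<eta>) W < n * \<delta>}
         \<subseteq> {W \<in> space (weight_space n). Lmax n (exp (-1) + \<eta>) W < k n - 1}" by force
    qed measurable
    also have "\<dots> \<le> exp (- (\<eta> / 32) * (\<beta> * hmin * f n - k n))"
    proof (rule long_light_path)
      fix x assume x: "1 \<le> x" "x < int N"
      show "hmin \<le> h x \<and> h x \<le> 1" using bounds[OF x] by simp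
      have "(1 + \<beta>) * h x * n \<le> (1 + \<eta> / 8) * h x * (n - \<eta> / 50 * n)"
      proof -
        have "\<eta> * \<eta> \<le> \<eta>" using \<eta> by (simp add: mult_left_le)
        moreover have "(1 + \<eta> / 8) * (1 - \<eta> / 50) = 1 + 21 / 200 * \<eta> - \<eta> * \<eta> / 400" by (simp add: field_simps)
        ultimately have "1 + \<beta> \<le> (1 + \<eta> / 8) * (1 - \<eta> / 50)" using \<eta> unfolding \<beta>_def by linarith
        then have "(1 + \<beta>) * (h x * n) \<le> (1 + \<eta> / 8) * (1 - \<eta> / 50) * (h x * n)"
          using h0[OF x] by (intro mult_right_mono) auto
        moreover have "n - \<eta> / 50 * n = (1 - \<eta> / 50) * n" by (simp add: algebra_simps)
        ultimately show ?thesis by (simp only: mult_ac)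
      qed
      also have "\<dots> \<le> (1 + \<eta> / 8) * h x * real (n - k n - f n)"
      proof (rule mult_left_mono)
        have r: "real (n - k n - f n) = real n - real (k n) - real (f n)" using fk' by (simp add: of_nat_diff)
        show "n - \<eta> / 50 * n \<le> real (n - k n - f n)" unfolding r using fk50 unfolding of_nat_add by linarith
      qed (use h0[OF x] \<eta> in auto)
      finally show "(1 + \<beta>) * h x \<le> (1 + \<eta> / 8) * h x / n * real (n - k n - f n)"
        using n by (simp add: field_simps)
    next
      show "0 \<le> \<beta>" using \<eta> by (simp add: \<beta>_def)
      show "2 \<le> k n" using elim by simp
      have "eps * L = exp (-1) + \<eta> / 2" using L by (simp add: eps_def)
      then show "eps * L + eps * N / (real (k n) - 1) \<le> exp (-1) + \<eta>" using elim(1) by linarith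
    qed
    also have "\<dots> \<le> exp (- (\<eta> / 32) * (\<kappa> * n - 1))"
    proof -
      have "0 \<le> \<beta>" "\<beta> \<le> 1" using \<eta> by (auto simp: \<beta>_def)
      then have b: "0 \<le> \<beta> * hmin" "\<beta> * hmin \<le> 1"
        using hmin by (auto intro!: mult_le_one)
      have "\<beta> * hmin * (\<eta> / 100 * n - 1) \<le> \<beta> * hmin * f n" using fn(2) b(1) by (rule mult_left_mono)
      moreover have "\<beta> * hmin * (\<eta> / 100 * n - 1) = 2 * (\<kappa> * n) - \<beta> * hmin"
        by (simp add: \<kappa>' \<beta>_def algebra_simps)
      ultimately have "\<kappa> * n - 1 \<le> \<beta> * hmin * f n - k n" using b kn by linarith
      then have "\<eta> / 32 * (\<kappa> * n - 1) \<le> \<eta> / 32 * (\<beta> * hmin * f n - k n)"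
        by (rule mult_left_mono) (use \<eta> in simp)
      then show ?thesis by simp
    qed
    finally show ?case .
  qed
qed simp

lemma Lmax_lower_tail:
  fixes \<eta> :: real
  assumes \<eta>: "0 < \<eta>" "\<eta> \<le> 1"
  shows "(\<lambda>n. measure (weight_space n) {W \<in> space (weight_space n).
     Lmax n (exp (-1) + \<eta>) W < n * exp (- 312 / sqrt \<eta>)}) \<longlonglongrightarrow> 0"
proof -
  define z where "z = 1 / sqrt \<eta>"
  have z: "1 \<le> z" using \<eta> by (simp add: z_def)
  have z2: "\<eta> * z\<^sup>2 = 1" using \<eta> by (simp add: z_def power_divide)
  define m where "m = nat \<lceil>12 * z\<rceil>"
  have m: "12 * z \<le> m" "m \<le> 13 * z" using z unfolding m_def by linarith+
  have m4: "4 \<le> m" using m(1) z by linarith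
  have "(12 * z)\<^sup>2 \<le> (real m)\<^sup>2" using m z by (intro power_mono) auto
  then have "\<eta> * (12 * z)\<^sup>2 \<le> \<eta> * (real m)\<^sup>2" using \<eta> by (intro mult_left_mono) auto
  then have m144: "144 \<le> \<eta> * (real m)\<^sup>2" using z2 by (simp add: power_mult_distrib)
  define \<kappa> where "\<kappa> = \<eta>\<^sup>2 * (exp (- (4 * real m)) / real m ^ 3) / 3200"
  have m0: "0 < real m" using m4 by simp
  \<comment> \<open>Since \<eta> is at least \<open>1 / m^2\<close>, \<kappa> is at least
    \<open>exp (- 4 m) / (3200 m^7)\<close>. Of the exponent 23, 4 matches the exponential, 7 pays
    for \<open>m^7\<close> and 12 for 3200, as \<open>2^12 = 4096\<close>. Together with
    \<open>m \<le> 13 / sqrt \<eta>\<close> this gives 312 = 24 * 13.\<close>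
  have "exp (- (24 * real m)) < exp (- (23 * real m))" using m0 by simp
  also have "\<dots> = exp (- (4 * real m) - 19 * real m)" by simp
  also have "\<dots> = exp (- (4 * real m)) / exp (19 * real m)" by (rule exp_diff)
  also have "exp (19 * real m) = exp (real m) ^ 7 * exp (12 * real m)"
    by (simp add: exp_of_nat_mult[symmetric] exp_add[symmetric])
  also have "exp (- (4 * real m)) / (exp (real m) ^ 7 * exp (12 * real m))
      = exp (- (4 * real m)) * (1 / (exp (real m) ^ 7 * exp (12 * real m)))" by simp
  also have "\<dots> \<le> exp (- (4 * real m)) * (1 / (real m ^ 7 * 3200))"
  proof (intro mult_left_mono divide_left_mono mult_mono power_mono)
    show "real m \<le> exp (real m)" using exp_ge_add_one_self[of "real m"] by linarith
    have "(2 :: real) ^ 12 \<le> exp 1 ^ 12" using exp_ge_add_one_self[of "1 :: real"] by (intro power_mono) auto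
    also have "\<dots> = exp 12" by (simp add: exp_of_nat_mult[symmetric])
    also have "\<dots> \<le> exp (12 * real m)" using m4 by simp
    finally show "3200 \<le> exp (12 * real m)" by simp
  qed (use m0 in auto)
  also have "\<dots> \<le> \<kappa>"
  proof -
    have "1 / (real m)\<^sup>2 \<le> \<eta>" using m144 m0 by (simp add: field_simps)
    then have "(1 / (real m)\<^sup>2)\<^sup>2 \<le> \<eta>\<^sup>2" by (intro power_mono) auto
    then have "(1 / (real m)\<^sup>2)\<^sup>2 * (exp (- (4 * real m)) / real m ^ 3) / 3200 \<le> \<kappa>"
      unfolding \<kappa>_def by (intro divide_right_mono mult_right_mono) auto
    then show ?thesis by (simp add: power_divide power_mult[symmetric] power_add[symmetric])
  qed
  finally have 1: "exp (- (24 * real m)) < \<kappa>" .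
  have "- 312 / sqrt \<eta> \<le> - (24 * real m)" using m(2) by (simp add: z_def)
  then have "exp (- 312 / sqrt \<eta>) \<le> exp (- (24 * real m))" by simp
  then have "exp (- 312 / sqrt \<eta>) < \<kappa>" using 1 by linarith
  then show ?thesis using eventually_long_light_path[OF \<eta> m4 m144 \<kappa>_def] by blast
qed

theorem theorem1p1:
  shows "\<exists>C1 C2 \<eta>s :: real. C1 > 0 \<and> C2 > 0 \<and> \<eta>s > 0 \<and>
    (\<forall>\<eta>. 0 < \<eta> \<and> \<eta> \<le> \<eta>s \<longrightarrow>
      ((\<lambda>n. measure (weight_space n)
          {W \<in> space (weight_space n).
             real n * exp (- C1 / sqrt \<eta>) \<le> real (Lmax n (exp (-1) + \<eta>) W) \<and>
             real (Lmax n (exp (-1) + \<eta>) W) \<le> real n * exp (- C2 / sqrt \<eta>)})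
       \<longlonglongrightarrow> 1))"
proof -
  obtain \<eta>0 :: real where \<eta>0: "0 < \<eta>0" and upper: "\<And>\<eta>. 0 < \<eta> \<Longrightarrow> \<eta> \<le> \<eta>0 \<Longrightarrow>
    (\<lambda>n. measure (weight_space n) {W \<in> space (weight_space n).
       n * exp (- (1 / 36) / sqrt \<eta>) < Lmax n (exp (-1) + \<eta>) W}) \<longlonglongrightarrow> 0"
    using Lmax_upper_tail by blast
  show ?thesis
  proof (rule exI[of _ 312], rule exI[of _ "1 / 36"], rule exI[of _ "min \<eta>0 1"], intro conjI allI impI)
    fix \<eta> :: real assume \<eta>: "0 < \<eta> \<and> \<eta> \<le> min \<eta>0 1"
    define X where "X n W = real (Lmax n (exp (-1) + \<eta>) W)" for n W
    define a where "a n = real n * exp (- 312 / sqrt \<eta>)" for n :: nat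
    define b where "b n = real n * exp (- (1 / 36) / sqrt \<eta>)" for n :: nat
    define A where "A n = measure (weight_space n) {W \<in> space (weight_space n). X n W < a n}" for n
    define B where "B n = measure (weight_space n) {W \<in> space (weight_space n). b n < X n W}" for n
    have A: "A \<longlonglongrightarrow> 0" unfolding A_def[abs_def] X_def a_def using \<eta> by (intro Lmax_lower_tail) auto
    have B: "B \<longlonglongrightarrow> 0" unfolding B_def[abs_def] X_def b_def using \<eta> by (intro upper) auto
    have "(\<lambda>n. measure (weight_space n) {W \<in> space (weight_space n). a n \<le> X n W \<and> X n W \<le> b n}) \<longlonglongrightarrow> 1"
    proof (rule tendsto_sandwich)
      show "(\<lambda>n. 1 - (A n + B n)) \<longlonglongrightarrow> 1" using tendsto_diff[OF tendsto_const tendsto_add[OF A B], of 1] by simp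
      show "eventually (\<lambda>n. 1 - (A n + B n) \<le> measure (weight_space n) {W \<in> space (weight_space n). a n \<le> X n W \<and> X n W \<le> b n}) sequentially"
        using eventually_gt_at_top[of 0]
      proof eventually_elim
        case (elim n)
        interpret W: prob_space "weight_space n" by (rule prob_space_weight_space[OF elim])
        have [measurable]: "X n \<in> borel_measurable (weight_space n)" unfolding X_def[abs_def] by (rule measurable_compose[OF Lmax_measurable]) simp
        have "W.prob (space (weight_space n) - {W \<in> space (weight_space n). a n \<le> X n W \<and> X n W \<le> b n})
            = W.prob ({W \<in> space (weight_space n). X n W < a n} \<union> {W \<in> space (weight_space n). b n < X n W})"
          by (intro arg_cong[of _ _ W.prob]) auto
        also have "\<dots> \<le> A n + B n" unfolding A_def B_def by (intro measure_Un_le) measurable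
        finally show ?case by (subst (asm) W.prob_compl) auto
      qed
      show "eventually (\<lambda>n. measure (weight_space n) {W \<in> space (weight_space n). a n \<le> X n W \<and> X n W \<le> b n} \<le> 1) sequentially"
        using eventually_gt_at_top[of 0]
        by eventually_elim (intro prob_space.prob_le_1 prob_space_weight_space)
    qed (rule tendsto_const)
    then show "(\<lambda>n. measure (weight_space n)
          {W \<in> space (weight_space n).
             real n * exp (- 312 / sqrt \<eta>) \<le> real (Lmax n (exp (-1) + \<eta>) W) \<and>
             real (Lmax n (exp (-1) + \<eta>) W) \<le> real n * exp (- (1 / 36) / sqrt \<eta>)}) \<longlonglongrightarrow> 1"
      by (simp only: X_def a_def b_def)
  qed (use \<eta>0 in auto)
qed

end
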